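(* If $M\equiv 1 \pmod 8$, then \[ (1,8,8,0,0,0)(M) = (1,14,14,0,0,0)(M) + 2(2,7,14,0,0,0)(M)+4(3,5,14,0,0,2)(M). \] If $M\equiv 1\pmod 8$ and $7\mid M$, then \[ 7(1,8,8,0,0,0)\left(\tfrac{M}{7^2}\right) = -(1,14,14,0,0,0)(M) - 2(2,7,14,0,0,0)(M)+4(3,5,14,0,0,2)(M). \]
   Context: For integers $a,b,c,d,e,f$ and a number $M$, $(a,b,c,d,e,f)(M):=|\{(x,y,z)\in\mathbb Z^3: M=ax^2+by^2+cz^2+dyz+ezx+fxy\}|$; in particular this count is $0$ when $M$ is not an integer. $M$ denotes a positive integer. *)

theory Defs
  imports Complex_Main "HOL-Number_Theory.Cong"
begin

text \<open>
  The number of representations of \<open>m\<close> by the ternary quadratic form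
  \<open>a x\<^sup>2 + b y\<^sup>2 + c z\<^sup>2 + d y z + e z x + f x y\<close>.
  The argument \<open>m\<close> is rational, so that arguments such as \<open>M / 7\<^sup>2\<close> are genuine quotients and
  the count is zero at non-integers. As \<open>card\<close> of an infinite set is zero, this is
  the number of representations only when that number is finite, in particular for
  positive definite forms.
\<close>

definition rep_count :: "int \<Rightarrow> int \<Rightarrow> int \<Rightarrow> int \<Rightarrow> int \<Rightarrow> int \<Rightarrow> rat \<Rightarrow> nat" where
  "rep_count a b c d e f m =
     card {(x :: int, y :: int, z :: int).
       m = of_int (a * x\<^sup>2 + b * y\<^sup>2 + c * z\<^sup>2 + d * y * z + e * z * x + f * x * y)}"

end

theory Submission
  imports Defs
begin

text \<open>
  Write \<open>f(M)\<close> for the number of representations by \<open>(1,8,8)\<close>, \<open>A(M)\<close> for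
  \<open>(1,14,14) + 2 (2,7,14)\<close> and \<open>B(M)\<close> for \<open>4 (3,5,14)\<close>.

  The lattice of \<open>(3,5,14)\<close> is, on the relevant residues modulo 8, the set of vectors
  of \<open>(1,8,8)\<close> orthogonal modulo 7 to one of the eight isotropic lines of \<open>x\<^sup>2 + y\<^sup>2 + z\<^sup>2\<close>
  modulo 7, and these lines are permuted transitively by signed permutations of the coordinates.
  Counting the lines orthogonal to each vector gives \<open>B(M) = (f(M) + 7 f(M/49)) / 2\<close> if \<open>7\<close>
  divides \<open>M\<close>, and \<open>B(M) = 0\<close> or \<open>f(M)\<close> according as \<open>M\<close> is a square modulo 7 or not.

  The form class of \<open>A\<close> lies in a different rational quadratic space, so it is not related to
  \<open>f\<close> by sublattices. Instead, by Jacobi's two square theorem both are sums of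
  the character modulo 4 over indefinite forms \<open>a X\<^sup>2 + 2 b X Y + c Y\<^sup>2\<close> with \<open>b\<^sup>2 - a c\<close> equal to
  \<open>M\<close> or \<open>4 M\<close> and \<open>a > 0 > c\<close>, those for \<open>A\<close> being restricted to forms with a
  given root modulo 7. Sums over such forms satisfy a three-term relation (the path from \<open>0\<close> to
  \<open>\<infinity>\<close> is the path from \<open>0\<close> to \<open>1\<close> followed by that from \<open>1\<close> to \<open>\<infinity>\<close>), and
  together with the obvious symmetries it expresses \<open>A(M)\<close> by the sum over all forms, each weighted
  by its number of roots on the projective line modulo 7. The same relation, with a
  quadratic weight, proves the two square theorem.
\<close>

section \<open>Sums over simple forms\<close>

text \<open>The nontrivial Dirichlet character modulo 4. It is odd, so negating a form negates a
  weight built from it.\<close>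

definition chi :: "int \<Rightarrow> int" where
  "chi n = (if n mod 4 = 1 then 1 else if n mod 4 = 3 then -1 else 0)"

text \<open>
  A triple \<open>(a, b, c)\<close> stands for the form \<open>a X\<^sup>2 + 2 b X Y + c Y\<^sup>2\<close>. The boundary forms
  vanish at \<open>(1,0)\<close>; they exist only for square \<open>N\<close>.
\<close>
definition simple_forms :: "int \<Rightarrow> (int \<times> int \<times> int) set" where
  "simple_forms N = {(a, b, c). b\<^sup>2 - a * c = N \<and> 0 < a \<and> c < 0}"

definition boundary_forms :: "int \<Rightarrow> (int \<times> int \<times> int) set" where
  "boundary_forms N = {(a, b, c). a = 0 \<and> b\<^sup>2 = N \<and> c < 0 \<and> 0 < 2 * b + c}"

lemma abs_le_square_int: "\<bar>b\<bar> \<le> b\<^sup>2" for b :: int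
  by (cases "b = 0") (use mult_left_mono[of 1 "\<bar>b\<bar>" "\<bar>b\<bar>"] in \<open>auto simp: power2_eq_square abs_mult_self_eq\<close>)

lemma finite_simple_forms: "finite (simple_forms N)"
proof (rule finite_subset)
  show "simple_forms N \<subseteq> {0..N} \<times> {-N..N} \<times> {-N..0}"
  proof
    fix Q assume "Q \<in> simple_forms N"
    then obtain a b c where Q: "Q = (a, b, c)" "b\<^sup>2 - a * c = N" "0 < a" "c < 0"
      by (auto simp: simple_forms_def)
    have "a * 1 \<le> a * (-c)" by (rule mult_left_mono) (use Q in auto)
    moreover have "1 * (-c) \<le> a * (-c)" by (rule mult_right_mono) (use Q in auto)
    moreover note abs_le_square_int[of b] zero_le_power2[of b]
    ultimately have "a \<le> N" "- N \<le> b" "b \<le> N" "- N \<le> c" using Q(2-4) by linarith+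
    then show "Q \<in> {0..N} \<times> {-N..N} \<times> {-N..0}" using Q by simp
  qed
qed auto

lemma sum_simple_reflect:
  fixes u :: "int \<Rightarrow> int \<Rightarrow> int \<Rightarrow> int"
  shows "(\<Sum>(a, b, c)\<in>simple_forms N. u a b c) = (\<Sum>(a, b, c)\<in>simple_forms N. u a (- b) c)"
  by (rule sum.reindex_bij_witness[where i = "\<lambda>(a, b, c). (a, -b, c)" and j = "\<lambda>(a, b, c). (a, -b, c)"])
     (auto simp: simple_forms_def)

text \<open>A form Q is sent to -Q(-Y, X): the quarter turn exchanges the signs at (1,0) and (0,1),
  and the negation restores them.\<close>

lemma sum_simple_swap:
  fixes u :: "int \<Rightarrow> int \<Rightarrow> int \<Rightarrow> int"
  shows "(\<Sum>(a, b, c)\<in>simple_forms N. u a b c) = (\<Sum>(a, b, c)\<in>simple_forms N. u (- c) b (- a))"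
  by (rule sum.reindex_bij_witness[where i = "\<lambda>(a, b, c). (-c, b, -a)" and j = "\<lambda>(a, b, c). (-c, b, -a)"])
     (auto simp: simple_forms_def mult.commute)

text \<open>
  A simple form \<open>Q\<close> changes sign between \<open>(1,0)\<close> and \<open>(0,1)\<close>, hence on exactly one side
  of \<open>(1,1)\<close> unless \<open>Q(1,1) = 0\<close>. The right-hand side also counts the forms negative only at
  \<open>(1,1)\<close> and their negatives, which cancel because \<open>u\<close> is odd.
\<close>
lemma sum_simple_three_term:
  fixes u :: "int \<Rightarrow> int \<Rightarrow> int \<Rightarrow> int"
  assumes odd: "\<And>a b c. u (- a) (- b) (- c) = - u a b c"
    and zero: "\<And>a b. b\<^sup>2 = N \<Longrightarrow> u a b 0 = 0"
    and mid: "\<And>a b c. b\<^sup>2 - a * c = N \<Longrightarrow> a + 2 * b + c = 0 \<Longrightarrow> u a b c = 0"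
  shows "(\<Sum>(a, b, c)\<in>simple_forms N. u a b c)
       = (\<Sum>(a, b, c)\<in>simple_forms N. u a (b - a) (a - 2 * b + c))
       + (\<Sum>(a, b, c)\<in>simple_forms N. u (a - 2 * b + c) (b - c) c)
       - (\<Sum>(a, b, c)\<in>boundary_forms N. u a b c)"
proof -
  define U where "U = (\<lambda>(a, b, c). u a b c)"
  \<comment> \<open>Forms are sorted by their signs at (1,0), (0,1) and (1,1), where the values are
    a, c and a + 2b + c.\<close>
  define R where "R = {(a, b, c). b\<^sup>2 - a * c = N \<and> 0 < a \<and> 0 < c \<and> a + 2 * b + c < 0}"
  define R0 where "R0 = {(a, b, c). b\<^sup>2 = N \<and> 0 < a \<and> c = 0 \<and> a + 2 * b + c < 0}"
  define R' where "R' = {(a, b, c). b\<^sup>2 - a * c = N \<and> a < 0 \<and> c < 0 \<and> 0 < a + 2 * b + c}"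
  define P1 where "P1 = {(a, b, c). b\<^sup>2 - a * c = N \<and> 0 < a \<and> c < 0 \<and> a + 2 * b + c < 0}"
  define P2 where "P2 = {(a, b, c). b\<^sup>2 - a * c = N \<and> 0 < a \<and> c < 0 \<and> 0 < a + 2 * b + c}"
  define P0 where "P0 = {(a, b, c). b\<^sup>2 - a * c = N \<and> 0 < a \<and> c < 0 \<and> a + 2 * b + c = 0}"
  let ?f = "\<lambda>(a, b, c). (a, b - a, a - 2 * b + c) :: int \<times> int \<times> int"
  let ?g = "\<lambda>(a, b, c). (a - 2 * b + c, b - c, c) :: int \<times> int \<times> int"
  \<comment> \<open>\<open>?f\<close> is Q(X - Y, Y): it takes the old values a and c at (1,0) and
    (1,1), and its sign at (0,1) is free.\<close>
  have f: "?f ` simple_forms N = P1 \<union> R \<union> R0"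
  proof (intro equalityI subsetI)
    fix Q assume "Q \<in> P1 \<union> R \<union> R0"
    then obtain a b c where Q: "Q = (a, b, c)" "b\<^sup>2 - a * c = N" "0 < a" "a + 2 * b + c < 0"
      by (auto simp: P1_def R_def R0_def)
    have "Q = ?f (a, a + b, a + 2 * b + c)" using Q by simp
    moreover have "(a, a + b, a + 2 * b + c) \<in> simple_forms N"
      using Q by (simp add: simple_forms_def power2_eq_square algebra_simps)
    ultimately show "Q \<in> ?f ` simple_forms N" by (rule image_eqI)
  next
    fix Q assume "Q \<in> ?f ` simple_forms N"
    then obtain a b c where Q: "Q = ?f (a, b, c)" "b\<^sup>2 - a * c = N" "0 < a" "c < 0"
      by (auto simp: simple_forms_def)
    have "(b - a)\<^sup>2 - a * (a - 2 * b + c) = N"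
      using Q(2) by (simp add: power2_eq_square algebra_simps)
    then show "Q \<in> P1 \<union> R \<union> R0"
      using Q by (cases "a - 2 * b + c" "0 :: int" rule: linorder_cases) (auto simp: P1_def R_def R0_def)
  qed
  \<comment> \<open>\<open>?g\<close> is Q(X, Y - X), with the old a and c at (1,1) and (0,1);
    images that vanish at (1,0) are the boundary forms.\<close>
  have g: "?g ` simple_forms N = P2 \<union> R' \<union> boundary_forms N"
  proof (intro equalityI subsetI)
    fix Q assume "Q \<in> P2 \<union> R' \<union> boundary_forms N"
    then obtain a b c where Q: "Q = (a, b, c)" "b\<^sup>2 - a * c = N" "c < 0" "a + 2 * b + c > 0"
      by (auto simp: P2_def R'_def boundary_forms_def)
    have "Q = ?g (a + 2 * b + c, b + c, c)" using Q by simp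
    moreover have "(a + 2 * b + c, b + c, c) \<in> simple_forms N"
      using Q by (simp add: simple_forms_def power2_eq_square algebra_simps)
    ultimately show "Q \<in> ?g ` simple_forms N" by (rule image_eqI)
  next
    fix Q assume "Q \<in> ?g ` simple_forms N"
    then obtain a b c where Q: "Q = ?g (a, b, c)" "b\<^sup>2 - a * c = N" "0 < a" "c < 0"
      by (auto simp: simple_forms_def)
    have "(b - c)\<^sup>2 - (a - 2 * b + c) * c = N"
      using Q(2) by (simp add: power2_eq_square algebra_simps)
    then show "Q \<in> P2 \<union> R' \<union> boundary_forms N"
      using Q by (cases "a - 2 * b + c" "0 :: int" rule: linorder_cases) (auto simp: P2_def R'_def boundary_forms_def)
  qed
  have fin: "finite (P1 \<union> R \<union> R0)" "finite (P2 \<union> R' \<union> boundary_forms N)"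
    unfolding f[symmetric] g[symmetric] by (intro finite_imageI finite_simple_forms)+
  have "simple_forms N = P1 \<union> P2 \<union> P0"
    by (auto simp: simple_forms_def P1_def P2_def P0_def)
  moreover have "finite P0"
    by (rule finite_subset[OF _ finite_simple_forms[of N]]) (auto simp: P0_def simple_forms_def)
  moreover have "sum U (P1 \<union> P2 \<union> P0) = sum U P1 + sum U P2 + sum U P0"
    using fin \<open>finite P0\<close>
    by (subst sum.union_disjoint; (subst sum.union_disjoint)?) (auto simp: P1_def P2_def P0_def)
  moreover have "sum U P0 = 0"
    by (rule sum.neutral) (auto simp: P0_def U_def mid)
  moreover have "sum (U \<circ> ?f) (simple_forms N) = sum U (P1 \<union> R \<union> R0)"
    unfolding f[symmetric] by (rule sum.reindex[symmetric]) (auto simp: inj_on_def)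
  moreover have "sum U (P1 \<union> R \<union> R0) = sum U P1 + sum U R + sum U R0"
    using fin
    by (subst sum.union_disjoint; (subst sum.union_disjoint)?) (auto simp: P1_def R_def R0_def)
  moreover have "sum U R0 = 0"
    by (rule sum.neutral) (auto simp: R0_def U_def zero)
  moreover have "sum (U \<circ> ?g) (simple_forms N) = sum U (P2 \<union> R' \<union> boundary_forms N)"
    unfolding g[symmetric] by (rule sum.reindex[symmetric]) (auto simp: inj_on_def)
  moreover have "sum U (P2 \<union> R' \<union> boundary_forms N) = sum U P2 + sum U R' + sum U (boundary_forms N)"
    using fin
    by (subst sum.union_disjoint; (subst sum.union_disjoint)?) (auto simp: P2_def R'_def boundary_forms_def)
  moreover have "sum U R' = - sum U R"
    unfolding sum_negf[symmetric]
    by (rule sum.reindex_bij_witness[where i = "\<lambda>(a, b, c). (-a, -b, -c)" and j = "\<lambda>(a, b, c). (-a, -b, -c)"])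
       (auto simp: R_def R'_def U_def odd)
  ultimately have "sum U (simple_forms N) = sum (U \<circ> ?f) (simple_forms N) + sum (U \<circ> ?g) (simple_forms N)
      - sum U (boundary_forms N)" by simp
  then show ?thesis by (simp add: U_def o_def case_prod_unfold)
qed

section \<open>Sums of two squares\<close>

lemma chi_minus: "chi (- n) = - chi n"
  unfolding chi_def by presburger

lemma chi_even: "even n \<Longrightarrow> chi n = 0"
  unfolding chi_def by presburger

lemma chi_cong: "a mod 4 = b mod 4 \<Longrightarrow> chi a = chi b"
  by (simp add: chi_def)

lemma chi_mult: "chi (a * b) = chi a * chi b"
proof -
  have "(a * b) mod 4 = ((a mod 4) * (b mod 4)) mod 4" by (simp add: mod_mult_eq)
  moreover have "a mod 4 = 0 \<or> a mod 4 = 1 \<or> a mod 4 = 2 \<or> a mod 4 = 3"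
    "b mod 4 = 0 \<or> b mod 4 = 1 \<or> b mod 4 = 2 \<or> b mod 4 = 3" by presburger+
  ultimately show ?thesis by (elim disjE) (simp_all add: chi_def)
qed

lemma odd_square_mod_8: "odd b \<Longrightarrow> b\<^sup>2 mod 8 = 1" for b :: int
proof -
  assume "odd b"
  then have "b mod 8 \<in> {1, 3, 5, 7}" by (simp; presburger)
  moreover have "b\<^sup>2 mod 8 = (b mod 8)\<^sup>2 mod 8" by (simp add: power_mod)
  ultimately show ?thesis by auto
qed

lemma mod_8_6: "n mod 8 = 6 \<Longrightarrow> even n \<and> \<not> 4 dvd n" for n :: int
  by presburger

lemma mod_4_1: "n mod 4 = 1 \<Longrightarrow> odd n" for n :: int
  by presburger

lemma even_square_mod_4: "even b \<Longrightarrow> b\<^sup>2 mod 4 = 0" for b :: int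
  by (auto simp: power2_eq_square elim!: evenE)

lemma sum_simple_reflect_zero:
  fixes u :: "int \<Rightarrow> int \<Rightarrow> int \<Rightarrow> int"
  assumes "\<And>a b c. u a (- b) c = - u a b c"
  shows "(\<Sum>(a, b, c)\<in>simple_forms N. u a b c) = 0"
  using sum_simple_reflect[of u N] by (simp add: assms case_prod_unfold sum_negf)

lemma sum_simple_swap_zero:
  fixes u :: "int \<Rightarrow> int \<Rightarrow> int \<Rightarrow> int"
  assumes "\<And>a b c. b\<^sup>2 - a * c = N \<Longrightarrow> u (- c) b (- a) = - u a b c"
  shows "(\<Sum>(a, b, c)\<in>simple_forms N. u a b c) = 0"
proof -
  have "(\<Sum>(a, b, c)\<in>simple_forms N. u a b c) = (\<Sum>(a, b, c)\<in>simple_forms N. - u a b c)"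
    unfolding sum_simple_swap[of u N] by (rule sum.cong) (auto simp: simple_forms_def assms)
  then show ?thesis by (simp add: case_prod_unfold sum_negf)
qed

text \<open>
  The weight \<open>a b + a c\<close> is chosen so that, up to terms odd in \<open>b\<close>, the
  three-term relation has only antisymmetric terms besides the required sum.
\<close>
lemma moment_simple_forms:
  assumes N: "N mod 8 = 3"
  shows "(\<Sum>(a, b, c)\<in>simple_forms N. if odd b then chi a * (a * c + 2 * b\<^sup>2) else 0) = 0"
proof -
  \<comment> \<open>N is not a square, so there are no boundary forms, and no form vanishes at
    (1,1), as this would give (a + b)^2 = N.\<close>
  have nsq: "x\<^sup>2 \<noteq> N" for x
    using odd_square_mod_8[of x] even_square_mod_4[of x] N by (cases "odd x"; presburger)
  have ob: "(a * c) mod 8 = 6" if "b\<^sup>2 - a * c = N" "odd b" for a b c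
    using odd_square_mod_8[OF that(2)] that(1) N by presburger
  have eb: "(a * c) mod 4 = 1" if "b\<^sup>2 - a * c = N" "even b" for a b c
    using even_square_mod_4[OF that(2)] that(1) N by presburger
  define u where "u a b c = (if odd b then chi a * (a * b + a * c) else 0)" for a b c :: int
  have "(\<Sum>(a, b, c)\<in>simple_forms N. u a b c)
       = (\<Sum>(a, b, c)\<in>simple_forms N. u a (b - a) (a - 2 * b + c))
       + (\<Sum>(a, b, c)\<in>simple_forms N. u (a - 2 * b + c) (b - c) c)
       - (\<Sum>(a, b, c)\<in>boundary_forms N. u a b c)"
  proof (rule sum_simple_three_term)
    show "u a b c = 0" if "b\<^sup>2 - a * c = N" "a + 2 * b + c = 0" for a b c
    proof -
      have "c = - a - 2 * b" using that(2) by simp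
      have "(a + b)\<^sup>2 = N" using that(1) unfolding \<open>c = - a - 2 * b\<close>
        by (simp add: power2_eq_square algebra_simps)
      then show ?thesis using nsq by blast
    qed
  qed (use nsq in \<open>auto simp: u_def chi_minus\<close>)
  moreover have "boundary_forms N = {}"
    using nsq by (auto simp: boundary_forms_def)
  \<comment> \<open>Only odd a survive the character, and then \<open>odd (b - a)\<close> means that
    b is even.\<close>
  moreover have "(\<Sum>(a, b, c)\<in>simple_forms N. u a (b - a) (a - 2 * b + c))
      = (\<Sum>(a, b, c)\<in>simple_forms N. (if even b then chi a * (a * c) else 0)
          - (if even b then chi a * (a * b) else 0))"
    by (rule sum.cong)
       (auto simp: u_def simple_forms_def algebra_simps power2_eq_square dest: chi_even)
  moreover have "(\<Sum>(a, b, c)\<in>simple_forms N. u (a - 2 * b + c) (b - c) c)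
      = (\<Sum>(a, b, c)\<in>simple_forms N. (if odd b then chi a * (a * b - 2 * b\<^sup>2 + b * c) else 0))"
  proof (rule sum.cong, simp, clarify)
    fix a b c assume "(a, b, c) \<in> simple_forms N"
    then have Q: "b\<^sup>2 - a * c = N" by (simp add: simple_forms_def)
    show "u (a - 2 * b + c) (b - c) c = (if odd b then chi a * (a * b - 2 * b\<^sup>2 + b * c) else 0)"
    proof (cases "odd b")
      case True
      note m = ob[OF Q True]
      show ?thesis
      proof (cases "odd a")
        case True
        have "\<not> 4 dvd c"
        proof
          assume "4 dvd c"
          then have "4 dvd a * c" by simp
          then show False using mod_8_6[OF m] by simp
        qed
        moreover have "even (a * c)" using mod_8_6[OF m] by simp
        with True have "even c" by simp
        ultimately have "c mod 4 = 2" by presburger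
        \<comment> \<open>Both c and 2b are 2 modulo 4, so they cancel there.\<close>
        then have "chi (a - 2 * b + c) = chi a"
          using \<open>odd b\<close> by (intro chi_cong) presburger
        then show ?thesis using \<open>odd b\<close> \<open>even c\<close>
          by (simp add: u_def algebra_simps power2_eq_square)
      next
        case False
        have "chi (a - 2 * b + c) = 0" if "even c"
          using False that by (intro chi_even) auto
        then show ?thesis using False \<open>odd b\<close> by (auto simp: u_def chi_even)
      qed
    next
      case False
      then have "odd (a * c)" using mod_4_1[OF eb[OF Q]] by simp
      then have "chi (a - 2 * b + c) = 0" by (intro chi_even) auto
      then show ?thesis using False by (simp add: u_def)
    qed
  qed
  \<comment> \<open>For even b the product ac is 1 modulo 4, so chi a = chi c, and replacing a by -c
    reverses the sign.\<close>
  moreover have "(\<Sum>(a, b, c)\<in>simple_forms N. (if even b then chi a * (a * c) else 0)) = 0"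
  proof (rule sum_simple_swap_zero)
    fix a b c assume Q: "b\<^sup>2 - a * c = N"
    have "chi (- c) = - chi a" if "even b"
    proof -
      have "chi (a * c) = 1" using eb[OF Q that] by (simp add: chi_def)
      then have "chi a = chi c" unfolding chi_mult by (metis zmult_eq_1_iff)
      then show ?thesis by (simp add: chi_minus)
    qed
    then show "(if even b then chi (- c) * (- c * - a) else 0) = - (if even b then chi a * (a * c) else 0)"
      by simp
  qed
  moreover have "(\<Sum>(a, b, c)\<in>simple_forms N. (if even b then chi a * (a * b) else 0)) = 0"
    by (rule sum_simple_reflect_zero) auto
  moreover have "(\<Sum>(a, b, c)\<in>simple_forms N. (if odd b then chi a * (b * c) else 0)) = 0"
    by (rule sum_simple_reflect_zero) auto
  moreover have "(\<Sum>(a, b, c)\<in>simple_forms N. if odd b then chi a * (a * c + 2 * b\<^sup>2) else 0)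
      = (\<Sum>(a, b, c)\<in>simple_forms N. u a b c)
      - (\<Sum>(a, b, c)\<in>simple_forms N. (if odd b then chi a * (a * b - 2 * b\<^sup>2 + b * c) else 0))
      + (\<Sum>(a, b, c)\<in>simple_forms N. (if odd b then chi a * (b * c) else 0))"
    unfolding sum_subtractf[symmetric] sum.distrib[symmetric]
    by (rule sum.cong) (auto simp: u_def algebra_simps)
  ultimately show ?thesis
    by (simp add: case_prod_unfold sum_subtractf)
qed

section \<open>Divisor sums of the character modulo 4\<close>

definition dsum :: "int \<Rightarrow> int" where
  "dsum n = (\<Sum>d | 0 < d \<and> d dvd n. chi d)"

text \<open>A triple is an x with an ordered factorisation of (N - x^2) / k, hence a simple form
  with middle coefficient x in which k is split off from -ac.\<close>

definition factor_triples :: "int \<Rightarrow> int \<Rightarrow> (int \<times> int \<times> int) set" where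
  "factor_triples k N = {(x, d, e). x\<^sup>2 + k * (d * e) = N \<and> 0 < d \<and> 0 < e}"

lemma finite_divisors_pos_int: "n > 0 \<Longrightarrow> finite {d :: int. 0 < d \<and> d dvd n}"
  by (rule finite_subset[of _ "{0..n}"]) (auto dest: zdvd_imp_le)

lemma finite_square_less: "finite {x :: int. x\<^sup>2 < N \<and> P x}"
proof (rule finite_subset)
  show "{x :: int. x\<^sup>2 < N \<and> P x} \<subseteq> {-N..N}"
  proof
    fix x assume "x \<in> {x :: int. x\<^sup>2 < N \<and> P x}"
    then show "x \<in> {-N..N}" using abs_le_square_int[of x] by (auto simp: abs_le_iff)
  qed
qed simp

lemma finite_square_le: "finite {x :: int. x\<^sup>2 \<le> N \<and> P x}"
  using finite_square_less[of "N + 1" P] by simp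

lemma finite_factor_triples:
  assumes "k > 0"
  shows "finite (factor_triples k N)"
proof (rule finite_subset)
  show "factor_triples k N \<subseteq> {x. x\<^sup>2 < N \<and> True} \<times> {0..N} \<times> {0..N}"
  proof
    fix q assume "q \<in> factor_triples k N"
    then obtain x d e where q: "q = (x, d, e)" "x\<^sup>2 + k * (d * e) = N" "0 < d" "0 < e"
      by (auto simp: factor_triples_def)
    have "1 * (d * e) \<le> k * (d * e)" by (rule mult_right_mono) (use assms q in auto)
    moreover have "d * 1 \<le> d * e" by (rule mult_left_mono) (use q in auto)
    moreover have "1 * e \<le> d * e" by (rule mult_right_mono) (use q in auto)
    moreover note zero_le_power2[of x]
    ultimately have "d \<le> N" "e \<le> N" "x\<^sup>2 < N" using q(2-4) by linarith+
    then show "q \<in> {x. x\<^sup>2 < N \<and> True} \<times> {0..N} \<times> {0..N}" using q by simp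
  qed
qed (use finite_square_less[of N "\<lambda>_. True"] in simp)

lemma sum_factor_triples:
  assumes "k > 0"
  shows "(\<Sum>(x, d, e)\<in>factor_triples k N. h x * chi d)
       = (\<Sum>x | x\<^sup>2 < N \<and> k dvd N - x\<^sup>2. h x * dsum ((N - x\<^sup>2) div k))"
proof -
  let ?X = "{x. x\<^sup>2 < N \<and> k dvd N - x\<^sup>2}"
  let ?n = "\<lambda>x. (N - x\<^sup>2) div k"
  let ?D = "\<lambda>x. {d. 0 < d \<and> d dvd ?n x}"
  have pos: "0 < ?n x" if x: "x \<in> ?X" for x
  proof -
    obtain j where "N - x\<^sup>2 = k * j" using x by (auto elim: dvdE)
    moreover have "0 < N - x\<^sup>2" using x by simp
    ultimately show ?thesis using assms by (simp add: zero_less_mult_iff)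
  qed
  have "(\<Sum>x\<in>?X. h x * dsum (?n x)) = (\<Sum>x\<in>?X. \<Sum>d\<in>?D x. h x * chi d)"
    by (simp add: dsum_def sum_distrib_left)
  also have "\<dots> = (\<Sum>(x, d)\<in>Sigma ?X ?D. h x * chi d)"
    by (rule sum.Sigma) (auto intro!: finite_square_less finite_divisors_pos_int pos)
  also have "\<dots> = (\<Sum>(x, d, e)\<in>factor_triples k N. h x * chi d)"
  proof (rule sum.reindex_bij_witness[where j = "\<lambda>(x, d). (x, d, ?n x div d)" and i = "\<lambda>(x, d, e). (x, d)"])
    fix p assume "p \<in> Sigma ?X ?D"
    then obtain x d where p: "p = (x, d)" "x \<in> ?X" "0 < d" "d dvd ?n x" by auto
    then obtain e where e: "?n x = d * e" by (auto elim: dvdE)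
    moreover have "0 < e" using pos[OF p(2)] p(3) e by (simp add: zero_less_mult_iff)
    moreover have "N - x\<^sup>2 = k * ?n x" using p(2) by simp
    ultimately show "(case p of (x, d) \<Rightarrow> (x, d, ?n x div d)) \<in> factor_triples k N"
      using p by (simp add: factor_triples_def)
  next
    fix q assume "q \<in> factor_triples k N"
    then obtain x d e where q: "q = (x, d, e)" "x\<^sup>2 + k * (d * e) = N" "0 < d" "0 < e"
      by (auto simp: factor_triples_def)
    then have "N - x\<^sup>2 = k * (d * e)" by simp
    moreover have "0 < k * (d * e)" using assms q by simp
    moreover have "x\<^sup>2 < N" using calculation by linarith
    ultimately have "x \<in> ?X" "?n x = d * e" using assms by auto
    then show "(case q of (x, d, e) \<Rightarrow> (x, d)) \<in> Sigma ?X ?D"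
      "(case case q of (x, d, e) \<Rightarrow> (x, d) of (x, d) \<Rightarrow> (x, d, ?n x div d)) = q"
      using q by auto
  qed auto
  finally show ?thesis by simp
qed

text \<open>This is \<open>moment_simple_forms\<close> carried along (x, d, e) -> (d, x, -2e); since
  ac = b^2 - N, the weight ac + 2 b^2 is 3 x^2 - N. For odd a and b, c is even, which accounts for
  the factor 2.\<close>

lemma moment_dsum:
  assumes N: "N mod 8 = 3"
  shows "(\<Sum>x | x\<^sup>2 < N \<and> 2 dvd N - x\<^sup>2. (3 * x\<^sup>2 - N) * dsum ((N - x\<^sup>2) div 2)) = 0"
proof -
  have "(\<Sum>x | x\<^sup>2 < N \<and> 2 dvd N - x\<^sup>2. (3 * x\<^sup>2 - N) * dsum ((N - x\<^sup>2) div 2))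
    = (\<Sum>(x, d, e)\<in>factor_triples 2 N. (3 * x\<^sup>2 - N) * chi d)"
    by (rule sum_factor_triples[symmetric]) simp
  also have "\<dots> = (\<Sum>(x, d, e)\<in>{(x, d, e) \<in> factor_triples 2 N. odd d}. (3 * x\<^sup>2 - N) * chi d)"
    by (rule sum.mono_neutral_right) (auto simp: finite_factor_triples chi_even)
  also have "\<dots> = (\<Sum>(a, b, c)\<in>{(a, b, c) \<in> simple_forms N. odd b \<and> odd a}. chi a * (a * c + 2 * b\<^sup>2))"
  proof (rule sum.reindex_bij_witness[where j = "\<lambda>(x, d, e). (d, x, - 2 * e)" and i = "\<lambda>(a, b, c). (b, a, - c div 2)"])
    fix q assume "q \<in> {(a, b, c) \<in> simple_forms N. odd b \<and> odd a}"
    then obtain a b c where q: "q = (a, b, c)" "b\<^sup>2 - a * c = N" "0 < a" "c < 0" "odd b" "odd a"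
      by (auto simp: simple_forms_def)
    have "even (b\<^sup>2 - N)" using q(5) N by (simp; presburger)
    moreover have "b\<^sup>2 - N = a * c" using q(2) by simp
    ultimately obtain e where "c = 2 * e" using q(6) by (auto elim: evenE)
    moreover from this have "- c div 2 = - e" by simp
    ultimately show "(case q of (a, b, c) \<Rightarrow> (b, a, - c div 2)) \<in> {(x, d, e) \<in> factor_triples 2 N. odd d}"
      "(case case q of (a, b, c) \<Rightarrow> (b, a, - c div 2) of (x, d, e) \<Rightarrow> (d, x, - 2 * e)) = q"
      using q by (auto simp: factor_triples_def)
  next
    fix p assume "p \<in> {(x, d, e) \<in> factor_triples 2 N. odd d}"
    then obtain x d e where p: "p = (x, d, e)" "x\<^sup>2 + 2 * (d * e) = N" "0 < d" "0 < e" "odd d"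
      by (auto simp: factor_triples_def)
    have "odd (x\<^sup>2 + 2 * (d * e))" unfolding p(2) using N by presburger
    then show "(case p of (x, d, e) \<Rightarrow> (d, x, - 2 * e)) \<in> {(a, b, c) \<in> simple_forms N. odd b \<and> odd a}"
      using p by (auto simp: simple_forms_def)
  qed (auto simp: factor_triples_def algebra_simps)
  also have "\<dots> = (\<Sum>(a, b, c)\<in>simple_forms N. if odd b then chi a * (a * c + 2 * b\<^sup>2) else 0)"
    by (rule sum.mono_neutral_cong_left) (auto simp: finite_simple_forms dest: chi_even split: if_splits)
  also note moment_simple_forms[OF N]
  finally show ?thesis .
qed

section \<open>Representations by two odd squares\<close>

definition sum2_reps :: "int \<Rightarrow> (int \<times> int) set" where
  "sum2_reps n = {(y, z). y\<^sup>2 + z\<^sup>2 = n}"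

definition odd_sum2_reps :: "int \<Rightarrow> (int \<times> int) set" where
  "odd_sum2_reps n = {(y, z). odd y \<and> odd z \<and> y\<^sup>2 + z\<^sup>2 = n}"

lemma finite_sum2_reps: "finite (sum2_reps n)"
proof (rule finite_subset)
  show "sum2_reps n \<subseteq> {x. x\<^sup>2 \<le> n \<and> True} \<times> {x. x\<^sup>2 \<le> n \<and> True}"
    by (auto simp: sum2_reps_def)
qed (use finite_square_le[of n "\<lambda>_. True"] in simp)

lemma finite_odd_sum2_reps: "finite (odd_sum2_reps n)"
  by (rule finite_subset[OF _ finite_sum2_reps[of n]]) (auto simp: sum2_reps_def odd_sum2_reps_def)

text \<open>
  This recursion and \<open>moment_dsum\<close> have the same shape, and they determine the values
  at all \<open>m\<close> congruent to 1 modulo 4 from the value at \<open>m = 1\<close>.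
\<close>
lemma moment_odd_sum2:
  assumes N: "N mod 8 = 3"
  shows "(\<Sum>x | x\<^sup>2 < N \<and> 2 dvd N - x\<^sup>2. (3 * x\<^sup>2 - N) * int (card (odd_sum2_reps (N - x\<^sup>2)))) = 0"
proof -
  let ?X = "{x. x\<^sup>2 < N \<and> 2 dvd N - x\<^sup>2}"
  define T where "T = {(x, y, z). odd x \<and> odd y \<and> odd z \<and> x\<^sup>2 + y\<^sup>2 + z\<^sup>2 = (N :: int)}"
  have oN: "odd N" using N by presburger
  have xx: "odd x" if "x \<in> ?X" for x using that oN by auto
  have yz: "y\<^sup>2 + z\<^sup>2 > 0" if "odd y" for y z :: int
    using that by (cases "y = 0") (auto simp: sum_power2_gt_zero_iff)
  have T: "T = Sigma ?X (\<lambda>x. odd_sum2_reps (N - x\<^sup>2))"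
  proof (intro equalityI subsetI)
    fix q assume "q \<in> T"
    then obtain x y z where q: "q = (x, y, z)" "odd x" "odd y" "odd z" "x\<^sup>2 + y\<^sup>2 + z\<^sup>2 = N"
      by (auto simp: T_def)
    have "even (N - x\<^sup>2)" using oN q(2) by simp
    moreover have "x\<^sup>2 < N" using yz[OF q(3), of z] q(5) by linarith
    moreover have "y\<^sup>2 + z\<^sup>2 = N - x\<^sup>2" using q(5) by linarith
    ultimately show "q \<in> Sigma ?X (\<lambda>x. odd_sum2_reps (N - x\<^sup>2))"
      using q by (simp add: odd_sum2_reps_def)
  next
    fix q assume "q \<in> Sigma ?X (\<lambda>x. odd_sum2_reps (N - x\<^sup>2))"
    then obtain x y z where q: "q = (x, y, z)" "x \<in> ?X" "odd y" "odd z" "y\<^sup>2 + z\<^sup>2 = N - x\<^sup>2"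
      by (auto simp: odd_sum2_reps_def)
    then show "q \<in> T" using xx[OF q(2)] by (simp add: T_def)
  qed
  have finT: "finite T"
  proof (rule finite_subset)
    show "T \<subseteq> {x. x\<^sup>2 \<le> N \<and> True} \<times> {x. x\<^sup>2 \<le> N \<and> True} \<times> {x. x\<^sup>2 \<le> N \<and> True}"
    proof
      fix p assume "p \<in> T"
      then obtain x y z where p: "p = (x, y, z)" "x\<^sup>2 + y\<^sup>2 + z\<^sup>2 = N" by (auto simp: T_def)
      then have "x\<^sup>2 \<le> N" "y\<^sup>2 \<le> N" "z\<^sup>2 \<le> N"
        using zero_le_power2[of x] zero_le_power2[of y] zero_le_power2[of z] by linarith+
      then show "p \<in> {x. x\<^sup>2 \<le> N \<and> True} \<times> {x. x\<^sup>2 \<le> N \<and> True} \<times> {x. x\<^sup>2 \<le> N \<and> True}"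
        using p(1) by simp
    qed
  qed (use finite_square_le[of N "\<lambda>_. True"] in simp)
  have "(\<Sum>x\<in>?X. (3 * x\<^sup>2 - N) * int (card (odd_sum2_reps (N - x\<^sup>2))))
      = (\<Sum>x\<in>?X. \<Sum>p\<in>odd_sum2_reps (N - x\<^sup>2). 3 * x\<^sup>2 - N)"
    by (simp add: mult.commute)
  also have "\<dots> = (\<Sum>(x, p)\<in>Sigma ?X (\<lambda>x. odd_sum2_reps (N - x\<^sup>2)). 3 * x\<^sup>2 - N)"
    by (rule sum.Sigma) (auto intro!: finite_square_less finite_odd_sum2_reps)
  also note T[symmetric]
  also have "(\<Sum>(x, p)\<in>T. 3 * x\<^sup>2 - N) = 3 * (\<Sum>(x, y, z)\<in>T. x\<^sup>2) - N * int (card T)"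
    by (simp add: case_prod_unfold sum_subtractf sum_distrib_left mult.commute)
  also have "\<dots> = 0"
  proof -
    \<comment> \<open>T is invariant under permutations of the coordinates, so x^2 averages to N / 3
      over T.\<close>
    have "(\<Sum>(x, y, z)\<in>T. x\<^sup>2) = (\<Sum>(x, y, z)\<in>T. y\<^sup>2)"
      by (rule sum.reindex_bij_witness[where i = "\<lambda>(x, y, z). (y, x, z)" and j = "\<lambda>(x, y, z). (y, x, z)"])
         (auto simp: T_def)
    moreover have "(\<Sum>(x, y, z)\<in>T. x\<^sup>2) = (\<Sum>(x, y, z)\<in>T. z\<^sup>2)"
      by (rule sum.reindex_bij_witness[where i = "\<lambda>(x, y, z). (z, y, x)" and j = "\<lambda>(x, y, z). (z, y, x)"])
         (auto simp: T_def)
    moreover have "(\<Sum>(x, y, z)\<in>T. x\<^sup>2) + (\<Sum>(x, y, z)\<in>T. y\<^sup>2) + (\<Sum>(x, y, z)\<in>T. z\<^sup>2)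
        = (\<Sum>(x, y, z)\<in>T. N)"
      unfolding sum.distrib[symmetric] by (rule sum.cong) (auto simp: T_def)
    ultimately show ?thesis by (simp add: case_prod_unfold mult.commute)
  qed
  finally show ?thesis .
qed

lemma dsum_1: "dsum 1 = 1"
proof -
  have "{d :: int. 0 < d \<and> d dvd 1} = {1}" by auto
  then show ?thesis by (simp add: dsum_def chi_def)
qed

lemma card_odd_sum2_reps_2: "card (odd_sum2_reps 2) = 4"
proof -
  have "odd_sum2_reps 2 = {(1, 1), (1, -1), (-1, 1), (-1, -1)}"
  proof (intro equalityI subsetI)
    fix p assume "p \<in> odd_sum2_reps 2"
    then obtain y z where p: "p = (y, z)" "odd y" "odd z" "y\<^sup>2 + z\<^sup>2 = 2"
      by (auto simp: odd_sum2_reps_def)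
    have "\<bar>y\<bar> \<le> 2" "\<bar>z\<bar> \<le> 2"
      using abs_le_square_int[of y] abs_le_square_int[of z] p(4) zero_le_power2[of y] zero_le_power2[of z]
      by linarith+
    then have "y \<in> {-1, 1}" "z \<in> {-1, 1}" using p(2,3) by (auto; presburger)+
    then show "p \<in> {(1, 1), (1, -1), (-1, 1), (-1, -1)}" using p(1) by auto
  qed (auto simp: odd_sum2_reps_def)
  then show ?thesis by simp
qed

text \<open>For N = 2m + 1 the difference of the two sides satisfies the common moment recursion.
  Its terms with |x| >= 3 vanish by induction, and x = 1, -1 carry the coefficient 3 - N, nonzero
  unless m = 1.\<close>

lemma card_odd_sum2_reps:
  assumes "m > 0" "m mod 4 = 1"
  shows "int (card (odd_sum2_reps (2 * m))) = 4 * dsum m"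
  using assms
proof (induction "nat m" arbitrary: m rule: less_induct)
  case less
  show ?case
  proof (cases "m = 1")
    case True
    then show ?thesis by (simp add: card_odd_sum2_reps_2 dsum_1)
  next
    case False
    define N where "N = 2 * m + 1"
    have N: "N mod 8 = 3" using less.prems(2) unfolding N_def by presburger
    let ?X = "{x. x\<^sup>2 < N \<and> 2 dvd N - x\<^sup>2}"
    let ?\<Delta> = "\<lambda>x. int (card (odd_sum2_reps (N - x\<^sup>2))) - 4 * dsum ((N - x\<^sup>2) div 2)"
    have "(\<Sum>x\<in>?X. (3 * x\<^sup>2 - N) * ?\<Delta> x)
        = (\<Sum>x\<in>?X. (3 * x\<^sup>2 - N) * int (card (odd_sum2_reps (N - x\<^sup>2))))
        - 4 * (\<Sum>x\<in>?X. (3 * x\<^sup>2 - N) * dsum ((N - x\<^sup>2) div 2))"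
      by (simp add: right_diff_distrib sum_subtractf sum_distrib_left mult.left_commute)
    also have "\<dots> = 0" using moment_dsum[OF N] moment_odd_sum2[OF N] by simp
    finally have "(\<Sum>x\<in>?X. (3 * x\<^sup>2 - N) * ?\<Delta> x) = 0" .
    moreover have "(\<Sum>x\<in>?X. (3 * x\<^sup>2 - N) * ?\<Delta> x) = (\<Sum>x\<in>{1, -1}. (3 * x\<^sup>2 - N) * ?\<Delta> x)"
    proof (rule sum.mono_neutral_right)
      show "finite ?X" by (rule finite_square_less)
      show "{1, -1} \<subseteq> ?X" using less.prems by (auto simp: N_def)
      show "\<forall>x\<in>?X - {1, -1}. (3 * x\<^sup>2 - N) * ?\<Delta> x = 0"
      proof
        fix x assume x: "x \<in> ?X - {1, -1}"
        then have ox: "odd x" by (auto simp: N_def)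
        note x8 = odd_square_mod_8[OF ox]
        define m' where "m' = (N - x\<^sup>2) div 2"
        have Nx: "N - x\<^sup>2 = 2 * m'" using x by (simp add: m'_def)
        have "\<bar>x\<bar> \<ge> 3" using x ox by (simp; presburger)
        then have "3 * 3 \<le> \<bar>x\<bar> * \<bar>x\<bar>" by (intro mult_mono) auto
        then have "x\<^sup>2 \<ge> 9" by (simp add: power2_eq_square abs_mult_self_eq)
        then have "m' < m" using Nx by (simp add: N_def)
        moreover have "m' > 0" using x Nx by simp
        moreover have "m' mod 4 = 1" using Nx x8 N by presburger
        ultimately have "int (card (odd_sum2_reps (2 * m'))) = 4 * dsum m'"
          by (intro less.hyps) auto
        then show "(3 * x\<^sup>2 - N) * ?\<Delta> x = 0" unfolding Nx by simp
      qed
    qed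
    ultimately have "(3 - N) * ?\<Delta> 1 = 0" by simp
    moreover have "3 - N \<noteq> 0" using False by (simp add: N_def)
    ultimately have "?\<Delta> 1 = 0" by simp
    then show ?thesis by (simp add: N_def)
  qed
qed

section \<open>From two odd squares to Jacobi's theorem for all n\<close>

lemma dsum_double:
  assumes "n > 0"
  shows "dsum (2 * n) = dsum n"
proof -
  have dvd: "d dvd n" if "d dvd 2 * n" "odd d" for d
    using that by (simp add: coprime_dvd_mult_right_iff)
  have "dsum (2 * n) = (\<Sum>d | 0 < d \<and> d dvd n \<and> odd d. chi d)"
    unfolding dsum_def using finite_divisors_pos_int[of "2 * n"] assms
    by (intro sum.mono_neutral_right)
       (auto intro: chi_even dvd)
  also have "\<dots> = dsum n"
    unfolding dsum_def using finite_divisors_pos_int[OF assms]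
    by (intro sum.mono_neutral_left) (auto intro: chi_even)
  finally show ?thesis .
qed

text \<open>The involution d -> n / d reverses the character, because chi d * chi (n / d) = chi n =
  -1.\<close>

lemma dsum_mod_4_3:
  assumes "n > 0" "n mod 4 = 3"
  shows "dsum n = 0"
proof -
  have "dsum n = (\<Sum>d | 0 < d \<and> d dvd n. - chi d)"
    unfolding dsum_def
  proof (rule sum.reindex_bij_witness[where i = "\<lambda>d. n div d" and j = "\<lambda>d. n div d"])
    fix d assume "d \<in> {d. 0 < d \<and> d dvd n}"
    then obtain e where e: "n = d * e" and d: "0 < d" by (auto elim: dvdE)
    then have "0 < e" using assms(1) by (simp add: zero_less_mult_iff)
    then show "n div (n div d) = d" "n div d \<in> {d. 0 < d \<and> d dvd n}"
      "n div (n div d) = d" "n div d \<in> {d. 0 < d \<and> d dvd n}" using d e by auto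
    have "chi d * chi e = -1" using assms(2) unfolding e chi_mult[symmetric] by (simp add: chi_def)
    moreover have "chi d = 0 \<or> chi d = 1 \<or> chi d = -1" by (simp add: chi_def)
    ultimately have "chi e = - chi d" by auto
    then show "- chi (n div d) = chi d" using d e by simp
  qed
  then show ?thesis by (simp add: dsum_def sum_negf)
qed

text \<open>Multiplication of y + iz by 1 + i, up to exchanging the coordinates, doubles the norm.
  It is onto because y and z have equal parity when y^2 + z^2 is even.\<close>

lemma card_sum2_reps_double: "card (sum2_reps (2 * n)) = card (sum2_reps n)"
proof (rule bij_betw_same_card[symmetric])
  show "bij_betw (\<lambda>(y, z). (y + z, y - z)) (sum2_reps n) (sum2_reps (2 * n))"
  proof (rule bij_betw_byWitness[where f' = "\<lambda>(y, z). ((y + z) div 2, (y - z) div 2)"])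
    have "\<exists>s t. y = s + t \<and> z = s - t" if "y\<^sup>2 + z\<^sup>2 = 2 * n" for y z :: int
    proof -
      have "even (y\<^sup>2 + z\<^sup>2)" using that by simp
      then have "even (y + z)" by simp
      then obtain s where "y + z = 2 * s" by (rule evenE)
      then have "y = s + (y - s) \<and> z = s - (y - s)" by simp
      then show ?thesis by blast
    qed
    note * = this
    show "\<forall>p\<in>sum2_reps (2 * n). (\<lambda>(y, z). (y + z, y - z)) ((\<lambda>(y, z). ((y + z) div 2, (y - z) div 2)) p) = p"
      by (auto simp: sum2_reps_def dest!: *)
    show "(\<lambda>(y, z). ((y + z) div 2, (y - z) div 2)) ` sum2_reps (2 * n) \<subseteq> sum2_reps n"
    proof
      fix q assume "q \<in> (\<lambda>(y, z). ((y + z) div 2, (y - z) div 2)) ` sum2_reps (2 * n)"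
      then obtain y z where q: "q = ((y + z) div 2, (y - z) div 2)" "y\<^sup>2 + z\<^sup>2 = 2 * n"
        by (auto simp: sum2_reps_def)
      obtain s t where st: "y = s + t" "z = s - t" using *[OF q(2)] by blast
      show "q \<in> sum2_reps n" using q unfolding st
        by (simp add: sum2_reps_def power2_eq_square algebra_simps)
    qed
  qed (auto simp: sum2_reps_def power2_eq_square algebra_simps)
qed

text \<open>Two squares add up to 2 modulo 8 only if both are odd, so after doubling every
  representation is an odd one.\<close>

lemma card_sum2_reps_mod_4_1:
  assumes "n mod 4 = 1"
  shows "card (sum2_reps n) = card (odd_sum2_reps (2 * n))"
proof -
  have "sum2_reps (2 * n) = odd_sum2_reps (2 * n)"
  proof -
    have "odd y \<and> odd z" if "y\<^sup>2 + z\<^sup>2 = 2 * n" for y z :: int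
      using that assms odd_square_mod_8[of y] odd_square_mod_8[of z]
        even_square_mod_4[of y] even_square_mod_4[of z]
      by (cases "odd y"; cases "odd z"; simp; presburger)
    then show ?thesis by (auto simp: sum2_reps_def odd_sum2_reps_def)
  qed
  then show ?thesis using card_sum2_reps_double[of n] by simp
qed

lemma sum2_reps_mod_4_3:
  assumes "n mod 4 = 3"
  shows "sum2_reps n = {}"
proof -
  have "y\<^sup>2 + z\<^sup>2 \<noteq> n" for y z :: int
    using assms odd_square_mod_8[of y] odd_square_mod_8[of z]
      even_square_mod_4[of y] even_square_mod_4[of z]
    by (cases "odd y"; cases "odd z"; simp; presburger)
  then show ?thesis by (auto simp: sum2_reps_def)
qed

text \<open>Jacobi's two square theorem. Doubling n changes neither side, the class 1 modulo 4 is
  \<open>card_odd_sum2_reps\<close>, and both sides vanish on the class 3.\<close>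

theorem card_sum2_reps:
  assumes "n > 0"
  shows "int (card (sum2_reps n)) = 4 * dsum n"
  using assms
proof (induction "nat n" arbitrary: n rule: less_induct)
  case less
  have "even n \<or> n mod 4 = 1 \<or> n mod 4 = 3" by presburger
  then consider "even n" | "n mod 4 = 1" | "n mod 4 = 3" by blast
  then show ?case
  proof cases
    case 1
    then obtain k where k: "n = 2 * k" by (rule evenE)
    then have "int (card (sum2_reps k)) = 4 * dsum k" using less.prems by (intro less.hyps) auto
    then show ?thesis using k less.prems by (simp add: card_sum2_reps_double dsum_double)
  next
    case 2
    then show ?thesis using less.prems by (simp add: card_sum2_reps_mod_4_1 card_odd_sum2_reps)
  next
    case 3
    then show ?thesis using less.prems by (simp add: sum2_reps_mod_4_3 dsum_mod_4_3)
  qed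
qed

section \<open>Forms with a given root modulo 7\<close>

definition form_value :: "int \<Rightarrow> int \<Rightarrow> int \<Rightarrow> int \<Rightarrow> int \<Rightarrow> int" where
  "form_value a b c x y = a * x\<^sup>2 + 2 * b * x * y + c * y\<^sup>2"

text \<open>The condition says that (x : y) is a root of the form on the projective line modulo 7.
  The parities of b are kept apart because a shear can change the parity.\<close>

definition odd_root_sum :: "int \<Rightarrow> int \<Rightarrow> int \<Rightarrow> int" where
  "odd_root_sum N x y =
     (\<Sum>(a, b, c)\<in>simple_forms N. if odd b \<and> 7 dvd form_value a b c x y then chi c else 0)"

definition even_root_sum :: "int \<Rightarrow> int \<Rightarrow> int \<Rightarrow> int" where
  "even_root_sum N x y =
     (\<Sum>(a, b, c)\<in>simple_forms N. if even b \<and> 7 dvd form_value a b c x y then chi c else 0)"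

definition boundary_sum :: "int \<Rightarrow> int \<Rightarrow> int \<Rightarrow> int" where
  "boundary_sum N x y =
     (\<Sum>(a, b, c)\<in>boundary_forms N. if 7 dvd form_value a b c x y then chi c else 0)"

lemma chi_add_2: "chi (n + 2) = - chi n"
  unfolding chi_def by presburger

lemma form_value_neg: "form_value (- a) (- b) (- c) x y = - form_value a b c x y"
  by (simp add: form_value_def)

lemma form_value_shear_left: "form_value a (b - a) (a - 2 * b + c) x y = form_value a b c (x - y) y"
  by (simp add: form_value_def power2_eq_square algebra_simps)

lemma form_value_shear_right: "form_value (a - 2 * b + c) (b - c) c x y = form_value a b c x (y - x)"
  by (simp add: form_value_def power2_eq_square algebra_simps)

lemma form_value_reflect: "form_value a (- b) c x y = form_value a b c (- x) y"
  by (simp add: form_value_def)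

lemma mod_4_3: "n mod 4 = 3 \<Longrightarrow> odd n" for n :: int
  by presburger

text \<open>Both b^2 and N are 1 modulo 8, so 8 divides ac, and c is odd.\<close>

lemma odd_middle_dvd_8:
  fixes a b c N :: int
  assumes "b\<^sup>2 - a * c = N" "N mod 8 = 1" "odd b" "odd c"
  shows "8 dvd a"
proof -
  have "(b\<^sup>2 - N) mod 8 = 0"
    using odd_square_mod_8[OF assms(3)] assms(2) by (metis mod_diff_eq diff_self mod_0)
  moreover have "b\<^sup>2 - N = a * c" using assms(1) by simp
  ultimately have "8 dvd a * c" by (simp add: mod_eq_0_iff_dvd)
  moreover have "coprime (8 :: int) c"
    using \<open>odd c\<close> coprime_power_left_iff[of 2 3 c] by simp
  ultimately show ?thesis by (simp add: coprime_dvd_mult_left_iff)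
qed

text \<open>Here ac = b^2 - N is 3 modulo 4, so chi a * chi c = -1.\<close>

lemma even_middle_cases:
  fixes a b c N :: int
  assumes "b\<^sup>2 - a * c = N" "N mod 4 = 1" "even b"
  shows "odd a" "odd c" "chi a = - chi c"
proof -
  have ac: "(a * c) mod 4 = 3"
    using even_square_mod_4[OF assms(3)] assms(1,2) by presburger
  then have "odd (a * c)" by (rule mod_4_3)
  then show "odd a" "odd c" by auto
  have "chi a * chi c = - 1" using ac unfolding chi_mult[symmetric] by (simp add: chi_def)
  moreover have "chi a = 0 \<or> chi a = 1 \<or> chi a = - 1" by (simp add: chi_def)
  ultimately show "chi a = - chi c" by auto
qed

text \<open>The three-term relation with weight chi c. The left shear adds a - 2b to c, which is 2
  modulo 4 and reverses the character; in the right shear c is odd, so an odd b - c means an even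
  b.\<close>

lemma odd_root_sum_three_term:
  assumes N: "N mod 8 = 1"
  shows "odd_root_sum N x y
       = - odd_root_sum N (x - y) y + even_root_sum N x (y - x) - boundary_sum N x y"
proof -
  have N4: "N mod 4 = 1" "odd N" using N by presburger+
  define u where "u a b c = (if odd b \<and> 7 dvd form_value a b c x y then chi c else 0)" for a b c
  have "(\<Sum>(a, b, c)\<in>simple_forms N. u a b c)
       = (\<Sum>(a, b, c)\<in>simple_forms N. u a (b - a) (a - 2 * b + c))
       + (\<Sum>(a, b, c)\<in>simple_forms N. u (a - 2 * b + c) (b - c) c)
       - (\<Sum>(a, b, c)\<in>boundary_forms N. u a b c)"
  proof (rule sum_simple_three_term)
    show "u a b c = 0" if "b\<^sup>2 - a * c = N" "a + 2 * b + c = 0" for a b c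
    proof (cases "odd b \<and> odd c")
      case True
      then have "even a" using odd_middle_dvd_8[OF that(1) N] by (auto intro: dvd_trans[of 2 8])
      moreover have "even (a + 2 * b + c)" using that(2) by simp
      ultimately show ?thesis using True by simp
    qed (auto simp: u_def chi_even)
  qed (auto simp: u_def form_value_neg chi_minus chi_even)
  moreover have "(\<Sum>(a, b, c)\<in>simple_forms N. u a (b - a) (a - 2 * b + c)) = - odd_root_sum N (x - y) y"
    unfolding odd_root_sum_def sum_negf[symmetric]
  proof (rule sum.cong, simp, clarify)
    fix a b c assume "(a, b, c) \<in> simple_forms N"
    then have Q: "b\<^sup>2 - a * c = N" by (simp add: simple_forms_def)
    show "u a (b - a) (a - 2 * b + c)
      = - (if odd b \<and> 7 dvd form_value a b c (x - y) y then chi c else 0)"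
    proof (cases "odd b \<and> odd c")
      case True
      then have "8 dvd a" using odd_middle_dvd_8[OF Q N] by simp
      then have "(a - 2 * b + c) mod 4 = (c + 2) mod 4" "even a" using True by presburger+
      then show ?thesis using True chi_cong[of "a - 2 * b + c" "c + 2"]
        by (simp add: u_def form_value_shear_left chi_add_2)
    next
      case False
      have "chi (a - 2 * b + c) = 0 \<or> even (b - a)"
      proof (cases "odd b")
        case True
        then have "even (b - a) \<or> even (a - 2 * b + c)" using False by auto
        then show ?thesis using chi_even by blast
      next
        case False
        then show ?thesis using even_middle_cases[OF Q N4(1)] by (intro disjI1 chi_even) auto
      qed
      then show ?thesis using False by (auto simp: u_def chi_even)
    qed
  qed
  moreover have "(\<Sum>(a, b, c)\<in>simple_forms N. u (a - 2 * b + c) (b - c) c) = even_root_sum N x (y - x)"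
    unfolding even_root_sum_def
    by (rule sum.cong) (auto simp: u_def form_value_shear_right chi_even)
  moreover have "(\<Sum>(a, b, c)\<in>boundary_forms N. u a b c) = boundary_sum N x y"
    unfolding boundary_sum_def
    by (rule sum.cong) (use N4 in \<open>auto simp: u_def boundary_forms_def\<close>)
  ultimately show ?thesis by (simp add: odd_root_sum_def u_def)
qed

lemma odd_root_sum_reflect: "odd_root_sum N (- x) y = odd_root_sum N x y"
  unfolding odd_root_sum_def
  by (subst sum_simple_reflect) (simp add: form_value_reflect)

lemma even_root_sum_reflect: "even_root_sum N (- x) y = even_root_sum N x y"
  unfolding even_root_sum_def
  by (subst sum_simple_reflect) (simp add: form_value_reflect)

text \<open>Passing to -Q(-Y, X) exchanges the root coordinates up to sign and replaces chi c by chi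
  (-a), which is the same for even b.\<close>

lemma even_root_sum_swap:
  assumes "N mod 4 = 1"
  shows "even_root_sum N y x = even_root_sum N x y"
proof -
  have "even_root_sum N y x = even_root_sum N (- y) x"
    by (simp add: even_root_sum_reflect)
  also have "\<dots> = even_root_sum N x y"
    unfolding even_root_sum_def
  proof (subst sum_simple_swap, rule sum.cong, simp, clarify)
    fix a b c assume "(a, b, c) \<in> simple_forms N"
    then have Q: "b\<^sup>2 - a * c = N" by (simp add: simple_forms_def)
    have "form_value (- c) b (- a) (- y) x = - form_value a b c x y"
      by (simp add: form_value_def algebra_simps)
    then show "(if even b \<and> 7 dvd form_value (- c) b (- a) (- y) x then chi (- a) else 0)
      = (if even b \<and> 7 dvd form_value a b c x y then chi c else 0)"
      using even_middle_cases(3)[OF Q assms] by (simp add: chi_minus)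
  qed
  finally show ?thesis .
qed

lemma chi_7: "chi 7 = - 1"
  by (simp add: chi_def)

text \<open>Moving a factor 7 from a to c keeps b^2 - ac and the signs, and multiplies chi c by chi
  7 = -1.\<close>

lemma sum_simple_scale_7:
  "(\<Sum>(a, b, c)\<in>simple_forms N. if P b \<and> 7 dvd a then chi c else 0)
   = - (\<Sum>(a, b, c)\<in>simple_forms N. if P b \<and> 7 dvd c then chi c else 0)"
proof -
  have "(\<Sum>(a, b, c)\<in>simple_forms N. if P b \<and> 7 dvd a then chi c else 0)
    = (\<Sum>(a, b, c)\<in>{(a, b, c) \<in> simple_forms N. P b \<and> 7 dvd a}. chi c)"
    by (rule sum.mono_neutral_cong_right) (auto simp: finite_simple_forms split: if_splits)
  also have "\<dots> = (\<Sum>(a, b, c)\<in>{(a, b, c) \<in> simple_forms N. P b \<and> 7 dvd c}. - chi c)"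
    by (rule sum.reindex_bij_witness[where i = "\<lambda>(a, b, c). (7 * a, b, c div 7)" and j = "\<lambda>(a, b, c). (a div 7, b, 7 * c)"])
       (auto simp: simple_forms_def chi_mult chi_7 elim!: dvdE)
  also have "\<dots> = (\<Sum>(a, b, c)\<in>simple_forms N. - (if P b \<and> 7 dvd c then chi c else 0))"
    by (rule sum.mono_neutral_cong_left) (auto simp: finite_simple_forms split: if_splits)
  finally show ?thesis by (simp add: case_prod_unfold sum_negf)
qed

lemma odd_root_sum_10: "odd_root_sum N 1 0 = - odd_root_sum N 0 1"
  using sum_simple_scale_7[where P = odd and N = N] by (simp add: odd_root_sum_def form_value_def)

lemma even_root_sum_10: "even_root_sum N 1 0 = - even_root_sum N 0 1"
  using sum_simple_scale_7[where P = even and N = N] by (simp add: even_root_sum_def form_value_def)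

text \<open>
  The even sums at \<open>(1,0)\<close> and \<open>(0,1)\<close> are opposite by scaling by 7 and equal by exchanging
  the coordinates, so they vanish.
\<close>
lemma odd_root_sum_relations:
  assumes N: "N mod 8 = 1"
  shows "odd_root_sum N 1 1 = - odd_root_sum N 0 1 - boundary_sum N 0 1"
    and "2 * odd_root_sum N 1 2 = - 2 * odd_root_sum N 0 1 + boundary_sum N 1 0 - boundary_sum N 1 2"
proof -
  have N4: "N mod 4 = 1" using N by presburger
  have "even_root_sum N 0 1 = 0"
    using even_root_sum_swap[OF N4, of 0 1] even_root_sum_10[of N] by simp
  then show "odd_root_sum N 1 1 = - odd_root_sum N 0 1 - boundary_sum N 0 1"
    using odd_root_sum_three_term[OF N, of 0 1] odd_root_sum_reflect[of N 1 1] by simp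
  \<comment> \<open>The relations at (1,0) and (1,2) thus contain the same even sum, which drops out
    of their difference.\<close>
  have "even_root_sum N 1 (- 1) = even_root_sum N 1 1"
    using even_root_sum_swap[OF N4, of 1 "- 1"] even_root_sum_reflect[of N 1 1] by simp
  then show "2 * odd_root_sum N 1 2 = - 2 * odd_root_sum N 0 1 + boundary_sum N 1 0 - boundary_sum N 1 2"
    using odd_root_sum_three_term[OF N, of 1 0] odd_root_sum_three_term[OF N, of 1 2]
      odd_root_sum_reflect[of N 1 2] odd_root_sum_10[of N] by simp
qed

section \<open>Counting roots on the projective line modulo 7\<close>

definition odd_sum :: "int \<Rightarrow> int" where
  "odd_sum N = (\<Sum>(a, b, c)\<in>simple_forms N. if odd b then chi c else 0)"

text \<open>The eight points make up the whole projective line over the field with 7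
  elements.\<close>

definition root_count :: "int \<Rightarrow> int \<Rightarrow> int \<Rightarrow> int" where
  "root_count a b c =
    of_bool (7 dvd form_value a b c 0 1) + of_bool (7 dvd form_value a b c 1 0)
      + of_bool (7 dvd form_value a b c 1 1) + of_bool (7 dvd form_value a b c (- 1) 1)
    + of_bool (7 dvd form_value a b c 1 2)
      + of_bool (7 dvd form_value a b c (- 1) 2) + of_bool (7 dvd form_value a b c 1 3)
      + of_bool (7 dvd form_value a b c (- 1) 3)"

text \<open>A nonzero binary form over this field has 1 plus the Legendre symbol of its discriminant
  many roots, and the nonzero squares are 1, 2, 4. The residue triples are checked
  exhaustively.\<close>

lemma root_count_eq:
  "root_count a b c =
    (if 7 dvd a \<and> 7 dvd b \<and> 7 dvd c then 8
     else if 7 dvd b\<^sup>2 - a * c then 1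
     else if (b\<^sup>2 - a * c) mod 7 \<in> {1, 2, 4} then 2 else 0)"
proof -
  define r s t where "r = a mod 7" and "s = b mod 7" and "t = c mod 7"
  have all: "\<forall>r\<in>set [0..6]. \<forall>s\<in>set [0..6]. \<forall>t\<in>set [0..6].
    of_bool (t mod 7 = 0) + of_bool (r mod 7 = 0)
      + of_bool ((r + 2 * s + t) mod 7 = 0) + of_bool ((r - 2 * s + t) mod 7 = 0)
      + of_bool ((r + 4 * s + 4 * t) mod 7 = 0) + of_bool ((r - 4 * s + 4 * t) mod 7 = 0)
      + of_bool ((r + 6 * s + 9 * t) mod 7 = 0) + of_bool ((r - 6 * s + 9 * t) mod 7 = 0) =
    (if r = 0 \<and> s = 0 \<and> t = 0 then 8
     else if (s * s - r * t) mod 7 = 0 then 1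
     else if (s * s - r * t) mod 7 \<in> {1, 2, 4} then 2 else (0 :: int))"
    by code_simp
  have mem: "n mod 7 \<in> set [0..6]" for n :: int
    using pos_mod_bound[of 7 n] by simp
  have cong: "(u * a + v * b + w * c) mod 7 = (u * r + v * s + w * t) mod 7" for u v w
    unfolding r_def s_def t_def by (intro mod_add_cong mod_mult_cong) auto
  have val: "7 dvd form_value a b c x y \<longleftrightarrow> (x\<^sup>2 * r + 2 * x * y * s + y\<^sup>2 * t) mod 7 = 0" for x y
    using cong[of "x\<^sup>2" "2 * x * y" "y\<^sup>2"]
    by (simp add: form_value_def dvd_eq_mod_eq_0 ac_simps)
  have disc: "(b\<^sup>2 - a * c) mod 7 = (s * s - r * t) mod 7"
    unfolding power2_eq_square r_def s_def t_def by (intro mod_diff_cong mod_mult_cong) auto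
  have "root_count a b c = of_bool (t mod 7 = 0) + of_bool (r mod 7 = 0)
      + of_bool ((r + 2 * s + t) mod 7 = 0) + of_bool ((r - 2 * s + t) mod 7 = 0)
      + of_bool ((r + 4 * s + 4 * t) mod 7 = 0) + of_bool ((r - 4 * s + 4 * t) mod 7 = 0)
      + of_bool ((r + 6 * s + 9 * t) mod 7 = 0) + of_bool ((r - 6 * s + 9 * t) mod 7 = 0)"
    unfolding root_count_def val by (simp add: ac_simps)
  also have "\<dots> = (if r = 0 \<and> s = 0 \<and> t = 0 then 8
     else if (s * s - r * t) mod 7 = 0 then 1
     else if (s * s - r * t) mod 7 \<in> {1, 2, 4} then 2 else 0)"
    by (rule all[rule_format]) (simp_all only: r_def s_def t_def mem)
  finally show ?thesis
    unfolding dvd_eq_mod_eq_0 disc r_def s_def t_def .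
qed

text \<open>Reflection in b identifies the sums at (x : y) and (-x : y), so the three doubled terms
  cover six points.\<close>

lemma eight_point_sum:
  "odd_root_sum N 0 1 + odd_root_sum N 1 0
     + 2 * (odd_root_sum N 1 1 + odd_root_sum N 1 2 + odd_root_sum N 1 3)
   = (\<Sum>(a, b, c)\<in>simple_forms N. if odd b then chi c * root_count a b c else 0)"
proof -
  have "odd_root_sum N 0 1 + odd_root_sum N 1 0
     + 2 * (odd_root_sum N 1 1 + odd_root_sum N 1 2 + odd_root_sum N 1 3)
   = odd_root_sum N 0 1 + (odd_root_sum N 1 0 + (odd_root_sum N 1 1 + (odd_root_sum N (- 1) 1
     + (odd_root_sum N 1 2 + (odd_root_sum N (- 1) 2 + (odd_root_sum N 1 3 + odd_root_sum N (- 1) 3))))))"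
    by (simp add: odd_root_sum_reflect)
  also have "\<dots> = (\<Sum>(a, b, c)\<in>simple_forms N. if odd b then chi c * root_count a b c else 0)"
    unfolding odd_root_sum_def sum.distrib[symmetric]
    by (rule sum.cong) (auto simp: root_count_def distrib_left)
  finally show ?thesis .
qed

text \<open>Dividing a form by 7 divides b^2 - ac by 49, keeps the parity of b and changes the
  character by chi 7 = -1.\<close>

lemma odd_sum_multiples_7:
  "(\<Sum>(a, b, c)\<in>simple_forms N. if odd b \<and> 7 dvd a \<and> 7 dvd b \<and> 7 dvd c then chi c else 0)
   = (if 49 dvd N then - odd_sum (N div 49) else 0)"
proof (cases "49 dvd N")
  case True
  then obtain K where K: "N = 49 * K" by (rule dvdE)
  have "(\<Sum>(a, b, c)\<in>simple_forms N. if odd b \<and> 7 dvd a \<and> 7 dvd b \<and> 7 dvd c then chi c else 0)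
    = (\<Sum>(a, b, c)\<in>{(a, b, c) \<in> simple_forms N. odd b \<and> 7 dvd a \<and> 7 dvd b \<and> 7 dvd c}. chi c)"
    by (rule sum.mono_neutral_cong_right) (auto simp: finite_simple_forms split: if_splits)
  also have "\<dots> = (\<Sum>(a, b, c)\<in>{(a, b, c) \<in> simple_forms K. odd b}. - chi c)"
    by (rule sum.reindex_bij_witness[where i = "\<lambda>(a, b, c). (7 * a, 7 * b, 7 * c)" and j = "\<lambda>(a, b, c). (a div 7, b div 7, c div 7)"])
       (auto simp: simple_forms_def chi_mult chi_7 K power2_eq_square elim!: dvdE[where b = 7])
  also have "\<dots> = (\<Sum>(a, b, c)\<in>simple_forms K. - (if odd b then chi c else 0))"
    by (rule sum.mono_neutral_cong_left) (auto simp: finite_simple_forms split: if_splits)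
  finally show ?thesis using K by (simp add: odd_sum_def case_prod_unfold sum_negf)
next
  case False
  have "49 dvd N" if Q: "b\<^sup>2 - a * c = N" "7 dvd a" "7 dvd b" "7 dvd c" for a b c
  proof -
    obtain a' b' c' where "a = 7 * a'" "b = 7 * b'" "c = 7 * c'"
      using Q(2-4) by (auto elim!: dvdE)
    then have "N = 49 * (b'\<^sup>2 - a' * c')" using Q(1) by (simp add: power2_eq_square algebra_simps)
    then show ?thesis by simp
  qed
  then show ?thesis using False
    by (intro trans[OF sum.neutral]) (auto simp: simple_forms_def)
qed

text \<open>If 7 divides N, every form has one root, except that a form divisible by 7 has 8; the
  surplus of 7 gives the term at N / 49.\<close>

lemma eight_point_sum_eq:
  "(\<Sum>(a, b, c)\<in>simple_forms N. if odd b then chi c * root_count a b c else 0)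
   = (if 7 dvd N then odd_sum N - (if 49 dvd N then 7 * odd_sum (N div 49) else 0)
      else if N mod 7 \<in> {1, 2, 4} then 2 * odd_sum N else 0)"
proof (cases "7 dvd N")
  case True
  have "(\<Sum>(a, b, c)\<in>simple_forms N. if odd b then chi c * root_count a b c else 0)
    = odd_sum N + 7 * (\<Sum>(a, b, c)\<in>simple_forms N. if odd b \<and> 7 dvd a \<and> 7 dvd b \<and> 7 dvd c then chi c else 0)"
    unfolding odd_sum_def sum_distrib_left sum.distrib[symmetric]
    by (rule sum.cong) (use True in \<open>auto simp: simple_forms_def root_count_eq\<close>)
  then show ?thesis using True by (simp add: odd_sum_multiples_7)
next
  case False
  have "\<not> (7 dvd a \<and> 7 dvd b \<and> 7 dvd c)" if "b\<^sup>2 - a * c = N" for a b c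
    using that False by (auto simp: power2_eq_square)
  then have "(\<Sum>(a, b, c)\<in>simple_forms N. if odd b then chi c * root_count a b c else 0)
    = (\<Sum>(a, b, c)\<in>simple_forms N. (if N mod 7 \<in> {1, 2, 4} then 2 else 0) * (if odd b then chi c else 0))"
    by (intro sum.cong) (use False in \<open>auto simp: simple_forms_def root_count_eq\<close>)
  then show ?thesis using False
    by (simp add: odd_sum_def case_prod_unfold sum_distrib_left)
qed

section \<open>Character sums over residue classes modulo 7\<close>

lemma sum_atLeastLessThan_int_upto: "(\<Sum>k=0..<n. g k) = (\<Sum>k\<leftarrow>[0..n - 1]. g k)" for n :: int
  using sum_list_distinct_conv_sum_set[of "[0..n - 1]" g] atLeastLessThanPlusOne_atLeastAtMost_int[of 0 "n - 1"]
  by simp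

lemma sum_periodic_28:
  fixes g :: "int \<Rightarrow> int"
  assumes per: "\<And>k. g (k + 28) = g k" and zero: "(\<Sum>k=0..<28. g k) = 0" and n: "0 \<le> n"
  shows "(\<Sum>k=0..<n. g k) = (\<Sum>k=0..<n mod 28. g k)"
proof -
  have step: "(\<Sum>k=0..<n + 28. g k) = (\<Sum>k=0..<n. g k)" if "0 \<le> n" for n
  proof -
    have "(\<Sum>k=0..<n + 28. g k) = (\<Sum>k=0..<28. g k) + (\<Sum>k=28..<n + 28. g k)"
      using that by (subst sum.union_disjoint[symmetric]) (auto intro!: sum.cong)
    also have "(\<Sum>k=28..<n + 28. g k) = (\<Sum>k=0..<n. g k)"
      by (rule sum.reindex_bij_witness[where i = "\<lambda>k. k + 28" and j = "\<lambda>k. k - 28"])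
         (use per[of "k - 28" for k] in auto)
    finally show ?thesis using zero by simp
  qed
  have "(\<Sum>k=0..<r + 28 * int q. g k) = (\<Sum>k=0..<r. g k)" if "0 \<le> r" for q r
  proof (induction q)
    case (Suc q)
    then show ?case using step[of "r + 28 * int q"] that by (simp add: algebra_simps)
  qed simp
  from this[of "n mod 28" "nat (n div 28)"] show ?thesis using n
    by (simp add: pos_imp_zdiv_nonneg_iff)
qed

definition chi_progression_sum :: "int \<Rightarrow> int \<Rightarrow> int" where
  "chi_progression_sum r n = (\<Sum>k=0..<n. if 7 dvd k - r then chi k else 0)"

text \<open>The summand has period 28, the least common multiple of 4 and 7, and each residue class
  modulo 7 sums to zero over a period.\<close>

lemma chi_progression_sum_mod:
  assumes "0 \<le> n"
  shows "chi_progression_sum r n = chi_progression_sum (r mod 7) (n mod 28)"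
proof -
  have shift: "7 dvd k - r \<longleftrightarrow> 7 dvd k - r mod 7" for k
    by (simp add: dvd_eq_mod_eq_0 mod_diff_right_eq)
  have "\<forall>s\<in>set [0..6]. (\<Sum>k\<leftarrow>[0..27]. if (k - s) mod 7 = 0 then chi k else 0) = 0"
    by code_simp
  moreover have "r mod 7 \<in> set [0..6]" using pos_mod_bound[of 7 r] by simp
  ultimately have "(\<Sum>k\<leftarrow>[0..27]. if (k - r mod 7) mod 7 = 0 then chi k else 0) = 0" by blast
  then have zero: "(\<Sum>k=0..<28. if 7 dvd k - r mod 7 then chi k else 0) = 0"
    by (simp add: sum_atLeastLessThan_int_upto dvd_eq_mod_eq_0)
  have per: "(if 7 dvd k + 28 - r mod 7 then chi (k + 28) else 0) = (if 7 dvd k - r mod 7 then chi k else 0)" for k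
  proof -
    have "7 dvd k + 28 - r mod 7 \<longleftrightarrow> 7 dvd k - r mod 7" by presburger
    moreover have "chi (k + 28) = chi k" by (rule chi_cong) presburger
    ultimately show ?thesis by simp
  qed
  show ?thesis unfolding chi_progression_sum_def shift
    using sum_periodic_28[OF per zero assms] by simp
qed

text \<open>These sums arise from the boundary forms of m^2 and (2m)^2. By periodicity only m modulo
  28 matters, and the odd classes are evaluated one by one.\<close>

lemma chi_progression_sum_combination:
  assumes "m > 0" "odd m"
  shows "2 * chi_progression_sum 0 (2 * m) + chi_progression_sum m (2 * m) - 2 * chi_progression_sum 0 (4 * m)
    = (if 7 dvd m then - 3 else 1)"
proof -
  define l where "l = m mod 28"
  have all: "\<forall>l\<in>set (filter odd [0..27]).
    2 * (\<Sum>k\<leftarrow>[0..(2 * l) mod 28 - 1]. if k mod 7 = 0 then chi k else 0)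
    + (\<Sum>k\<leftarrow>[0..(2 * l) mod 28 - 1]. if (k - l mod 7) mod 7 = 0 then chi k else 0)
    - 2 * (\<Sum>k\<leftarrow>[0..(4 * l) mod 28 - 1]. if k mod 7 = 0 then chi k else 0)
    = (if l mod 7 = 0 then - 3 else 1)"
    by code_simp
  have cps: "chi_progression_sum r n = (\<Sum>k\<leftarrow>[0..n - 1]. if (k - r) mod 7 = 0 then chi k else 0)" for r n
    unfolding chi_progression_sum_def
    by (simp add: sum_atLeastLessThan_int_upto dvd_eq_mod_eq_0)
  have "l \<in> set (filter odd [0..27])" using assms unfolding l_def by simp presburger
  note inst = all[rule_format, OF this]
  have m7: "m mod 7 = l mod 7" unfolding l_def by (simp add: mod_mod_cancel)
  have m2: "(2 * m) mod 28 = (2 * l) mod 28" "(4 * m) mod 28 = (4 * l) mod 28"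
    unfolding l_def by (simp_all add: mod_mult_right_eq)
  show "2 * chi_progression_sum 0 (2 * m) + chi_progression_sum m (2 * m) - 2 * chi_progression_sum 0 (4 * m)
    = (if 7 dvd m then - 3 else 1)"
    using inst assms(1) chi_progression_sum_mod[of "2 * m" 0] chi_progression_sum_mod[of "2 * m" m]
      chi_progression_sum_mod[of "4 * m" 0]
    unfolding m2 m7 cps dvd_eq_mod_eq_0 by simp
qed

section \<open>Boundary terms\<close>

text \<open>For N > 0 these are the representations with y = z = 0, which the divisor sums do not
  see.\<close>

definition sqrt_count :: "int \<Rightarrow> int" where
  "sqrt_count N = int (card {x. x\<^sup>2 = N})"

lemma sqrt_count_square: "m > 0 \<Longrightarrow> sqrt_count (m\<^sup>2) = 2"
proof -
  assume "m > 0"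
  have "{x. x\<^sup>2 = m\<^sup>2} = {m, - m}" by (auto simp: power2_eq_iff)
  then show ?thesis using \<open>m > 0\<close> by (simp add: sqrt_count_def)
qed

text \<open>The inequalities 2b > -c > 0 force b = m, so the boundary forms are (0, m, -k) with 0 <
  k < 2m. The index k = 0 contributes chi 0 = 0 and makes the range fit the periodic sums.\<close>

lemma boundary_sum_square:
  assumes "m > 0"
  shows "boundary_sum (m\<^sup>2) x y = - (\<Sum>k=0..<2 * m. if 7 dvd form_value 0 m (- k) x y then chi k else 0)"
proof -
  have "boundary_sum (m\<^sup>2) x y = (\<Sum>k=1..<2 * m. if 7 dvd form_value 0 m (- k) x y then - chi k else 0)"
    unfolding boundary_sum_def
    by (rule sum.reindex_bij_witness[where i = "\<lambda>k. (0, m, - k)" and j = "\<lambda>(a, b, c). - c"])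
       (use assms in \<open>auto simp: boundary_forms_def power2_eq_iff chi_minus[symmetric]\<close>)
  also have "\<dots> = (\<Sum>k=0..<2 * m. if 7 dvd form_value 0 m (- k) x y then - chi k else 0)"
  proof (rule sum.mono_neutral_left)
    have "chi k = 0" if "0 \<le> k" "\<not> 1 \<le> k" for k
      using that by (intro chi_even) presburger
    then show "\<forall>k\<in>{0..<2 * m} - {1..<2 * m}. (if 7 dvd form_value 0 m (- k) x y then - chi k else 0) = 0"
      by auto
  qed auto
  also have "\<dots> = (\<Sum>k=0..<2 * m. - (if 7 dvd form_value 0 m (- k) x y then chi k else 0))"
    by (rule sum.cong) auto
  finally show ?thesis by (simp add: sum_negf)
qed

lemma sum_chi_odd:
  assumes "m > 0" "odd m"
  shows "(\<Sum>k=0..<2 * m. chi k) = 1"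
proof -
  have "(\<Sum>k=0..<4 * int j + 2. chi k) = 1" for j
  proof (induction j)
    case (Suc j)
    have "{0..<4 * int (Suc j) + 2} = insert (4 * int j + 5) (insert (4 * int j + 4)
        (insert (4 * int j + 3) (insert (4 * int j + 2) {0..<4 * int j + 2})))" by auto
    moreover have "chi (4 * int j + 5) = 1" "chi (4 * int j + 3) = - 1"
      unfolding chi_def by presburger+
    ultimately show ?case using Suc by (simp add: chi_even)
  next
    case 0
    have "{0..<2 :: int} = {0, 1}" by auto
    then show ?case by (simp add: chi_def)
  qed
  note eq = this
  obtain j where j: "m = 2 * j + 1" using assms(2) by (rule oddE)
  then have "2 * m = 4 * int (nat j) + 2" using assms(1) by simp
  then show ?thesis using eq[of "nat j"] by simp
qed

text \<open>These are the boundary terms left when \<open>odd_root_sum_relations\<close> and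
  \<open>sum_odd_middle_4\<close> are inserted into the counts for (1,14,14) and (2,7,14). They
  vanish unless N is a square.\<close>

lemma boundary_combination:
  assumes "N mod 8 = 1" "N > 0"
  shows "2 * (- 2 * boundary_sum N 0 1 + boundary_sum N 1 0 - boundary_sum N 1 2 + 2 * boundary_sum (4 * N) 0 1)
       + sqrt_count N = (if 7 dvd N then - 3 else 1) * sqrt_count N"
proof (cases "\<exists>m. m\<^sup>2 = N")
  case True
  then obtain m0 where "m0\<^sup>2 = N" by blast
  then obtain m where m: "m\<^sup>2 = N" "0 \<le> m"
    by (metis abs_ge_zero power2_abs)
  then have "m > 0" using assms(2) by (cases "m = 0") auto
  have "odd N" using assms(1) by presburger
  then have "odd m" using m(1) by auto
  have b01: "boundary_sum N 0 1 = - chi_progression_sum 0 (2 * m)"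
    unfolding m(1)[symmetric] boundary_sum_square[OF \<open>m > 0\<close>]
    by (simp add: chi_progression_sum_def form_value_def)
  \<comment> \<open>Every form with a = 0 has the root (1 : 0), so the unrestricted character sum
    appears.\<close>
  have b10: "boundary_sum N 1 0 = - 1"
    unfolding m(1)[symmetric] boundary_sum_square[OF \<open>m > 0\<close>]
    using sum_chi_odd[OF \<open>m > 0\<close> \<open>odd m\<close>] by (simp add: form_value_def)
  have "7 dvd form_value 0 m (- k) 1 2 \<longleftrightarrow> 7 dvd k - m" for k
    unfolding form_value_def by (simp; presburger)
  then have b12: "boundary_sum N 1 2 = - chi_progression_sum m (2 * m)"
    unfolding m(1)[symmetric] boundary_sum_square[OF \<open>m > 0\<close>]
    by (simp add: chi_progression_sum_def)
  have "4 * N = (2 * m)\<^sup>2" using m(1) by (simp add: power_mult_distrib)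
  then have b4: "boundary_sum (4 * N) 0 1 = - chi_progression_sum 0 (4 * m)"
    using boundary_sum_square[of "2 * m" 0 1] \<open>m > 0\<close>
    by (simp add: chi_progression_sum_def form_value_def)
  have "7 dvd N \<longleftrightarrow> 7 dvd m" unfolding m(1)[symmetric]
    by (rule prime_dvd_power_iff) auto
  then show ?thesis
    using chi_progression_sum_combination[OF \<open>m > 0\<close> \<open>odd m\<close>] sqrt_count_square[OF \<open>m > 0\<close>]
    unfolding m(1) b01 b10 b12 b4 by (simp split: if_splits)
next
  case False
  have "boundary_forms N = {}" using False by (auto simp: boundary_forms_def)
  moreover have "boundary_forms (4 * N) = {}"
  proof -
    have False if "b\<^sup>2 = 4 * N" for b
    proof -
      have "even (b\<^sup>2)" using that by simp
      then have "even b" by simp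
      then obtain h where "b = 2 * h" by (rule evenE)
      then show False using that \<open>\<nexists>m. m\<^sup>2 = N\<close> by (simp add: power_mult_distrib)
    qed
    then show ?thesis by (auto simp: boundary_forms_def)
  qed
  ultimately show ?thesis using False by (simp add: boundary_sum_def sqrt_count_def)
qed

section \<open>The forms (1,8,8), (1,14,14) and (2,7,14)\<close>

text \<open>For each x the two square theorem is applied to (N - x^2) / k; if x^2 = N, only y = z =
  0 remains.\<close>

lemma card_ternary_sum2:
  assumes "k > 0" "N > 0"
  shows "int (card {(x, y, z). x\<^sup>2 + k * (y\<^sup>2 + z\<^sup>2) = N})
       = 4 * (\<Sum>(x, d, e)\<in>factor_triples k N. chi d) + sqrt_count N"
proof -
  let ?n = "\<lambda>x. (N - x\<^sup>2) div k"
  let ?X = "{x. x\<^sup>2 < N \<and> k dvd N - x\<^sup>2}" and ?Y = "{x. x\<^sup>2 = N}"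
  have "?Y = {x. x\<^sup>2 \<le> N \<and> x\<^sup>2 = N}" by auto
  then have fin: "finite ?X" "finite ?Y"
    by (auto simp only: intro: finite_square_less finite_square_le)
  have "{(x, y, z). x\<^sup>2 + k * (y\<^sup>2 + z\<^sup>2) = N} = Sigma (?X \<union> ?Y) (\<lambda>x. sum2_reps (?n x))"
  proof (intro equalityI subsetI)
    fix q assume "q \<in> {(x, y, z). x\<^sup>2 + k * (y\<^sup>2 + z\<^sup>2) = N}"
    then obtain x y z where q: "q = (x, y, z)" "x\<^sup>2 + k * (y\<^sup>2 + z\<^sup>2) = N" by auto
    then have e: "N - x\<^sup>2 = k * (y\<^sup>2 + z\<^sup>2)" by simp
    moreover have "0 \<le> k * (y\<^sup>2 + z\<^sup>2)" using assms by simp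
    ultimately have "x\<^sup>2 < N \<or> x\<^sup>2 = N" by linarith
    moreover have "k dvd N - x\<^sup>2" "?n x = y\<^sup>2 + z\<^sup>2" using e assms(1) by simp_all
    ultimately have "x \<in> ?X \<union> ?Y" "(y, z) \<in> sum2_reps (?n x)"
      by (auto simp: sum2_reps_def)
    then show "q \<in> Sigma (?X \<union> ?Y) (\<lambda>x. sum2_reps (?n x))"
      unfolding q(1) by (rule SigmaI)
  next
    fix q assume "q \<in> Sigma (?X \<union> ?Y) (\<lambda>x. sum2_reps (?n x))"
    then obtain x y z where q: "q = (x, y, z)" "x \<in> ?X \<union> ?Y" "y\<^sup>2 + z\<^sup>2 = ?n x"
      by (auto simp: sum2_reps_def)
    then have "k dvd N - x\<^sup>2" by auto
    then have "k * (y\<^sup>2 + z\<^sup>2) = N - x\<^sup>2" using q(3) by simp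
    then show "q \<in> {(x, y, z). x\<^sup>2 + k * (y\<^sup>2 + z\<^sup>2) = N}" using q(1) by simp
  qed
  then have "int (card {(x, y, z). x\<^sup>2 + k * (y\<^sup>2 + z\<^sup>2) = N}) = (\<Sum>x\<in>?X \<union> ?Y. int (card (sum2_reps (?n x))))"
    using fin by (simp add: card_SigmaI finite_sum2_reps)
  also have "\<dots> = (\<Sum>x\<in>?X. int (card (sum2_reps (?n x)))) + (\<Sum>x\<in>?Y. int (card (sum2_reps (?n x))))"
    by (rule sum.union_disjoint) (use fin in auto)
  also have "(\<Sum>x\<in>?X. int (card (sum2_reps (?n x)))) = (\<Sum>x\<in>?X. 4 * dsum (?n x))"
  proof (rule sum.cong)
    fix x assume x: "x \<in> ?X"
    then obtain j where "N - x\<^sup>2 = k * j" by (auto elim: dvdE)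
    moreover have "0 < N - x\<^sup>2" using x by simp
    ultimately have "0 < ?n x" using assms(1) by (simp add: zero_less_mult_iff)
    then show "int (card (sum2_reps (?n x))) = 4 * dsum (?n x)" by (rule card_sum2_reps)
  qed simp
  also have "(\<Sum>x\<in>?Y. int (card (sum2_reps (?n x)))) = sqrt_count N"
  proof -
    have "sum2_reps 0 = {(0, 0)}" by (auto simp: sum2_reps_def sum_power2_eq_zero_iff)
    then show ?thesis by (simp add: sqrt_count_def)
  qed
  finally show ?thesis
    using sum_factor_triples[OF assms(1), of "\<lambda>_. 4" N]
    by (simp add: sum_distrib_left case_prod_unfold)
qed

text \<open>The triple (x, d, e) becomes the form (8qe, x, -d), whence the minus sign. Conversely,
  odd b and c already force 8 to divide a.\<close>

lemma sum_factor_triples_8: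
  assumes N: "N mod 8 = 1" and q: "q > 0" "odd q"
  shows "(\<Sum>(x, d, e)\<in>factor_triples (8 * q) N. chi d)
       = - (\<Sum>(a, b, c)\<in>simple_forms N. if odd b \<and> q dvd a then chi c else 0)"
proof -
  have "odd N" using N by presburger
  have "(\<Sum>(x, d, e)\<in>factor_triples (8 * q) N. chi d)
      = (\<Sum>(x, d, e)\<in>{(x, d, e) \<in> factor_triples (8 * q) N. odd d}. chi d)"
    by (rule sum.mono_neutral_right) (use q in \<open>auto simp: finite_factor_triples chi_even\<close>)
  also have "\<dots> = (\<Sum>(a, b, c)\<in>{(a, b, c) \<in> simple_forms N. odd b \<and> odd c \<and> q dvd a}. - chi c)"
  proof (rule sum.reindex_bij_witness[where j = "\<lambda>(x, d, e). (8 * q * e, x, - d)" and i = "\<lambda>(a, b, c). (b, - c, a div (8 * q))"])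
    fix p assume "p \<in> {(x, d, e) \<in> factor_triples (8 * q) N. odd d}"
    then obtain x d e where p: "p = (x, d, e)" "x\<^sup>2 + 8 * q * (d * e) = N" "0 < d" "0 < e" "odd d"
      by (auto simp: factor_triples_def)
    have "odd (x\<^sup>2 + 8 * q * (d * e))" unfolding p(2) by (rule \<open>odd N\<close>)
    then have "odd x" by simp
    then show "(case p of (x, d, e) \<Rightarrow> (8 * q * e, x, - d)) \<in> {(a, b, c) \<in> simple_forms N. odd b \<and> odd c \<and> q dvd a}"
      using p q by (auto simp: simple_forms_def algebra_simps)
  next
    fix p assume "p \<in> {(a, b, c) \<in> simple_forms N. odd b \<and> odd c \<and> q dvd a}"
    then obtain a b c where p: "p = (a, b, c)" "b\<^sup>2 - a * c = N" "0 < a" "c < 0" "odd b" "odd c" "q dvd a"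
      by (auto simp: simple_forms_def)
    have "8 dvd a" by (rule odd_middle_dvd_8[OF p(2) N p(5,6)])
    moreover have "coprime 8 q" using q(2) coprime_power_left_iff[of 2 3 q] by simp
    ultimately have "8 * q dvd a" using p(7) by (simp add: divides_mult)
    then obtain e where e: "a = 8 * q * e" by (rule dvdE)
    then have "0 < e" using p(3) q(1) by (simp add: zero_less_mult_iff)
    then show "(case p of (a, b, c) \<Rightarrow> (b, - c, a div (8 * q))) \<in> {(x, d, e) \<in> factor_triples (8 * q) N. odd d}"
      "(case case p of (a, b, c) \<Rightarrow> (b, - c, a div (8 * q)) of (x, d, e) \<Rightarrow> (8 * q * e, x, - d)) = p"
      using p q e by (auto simp: factor_triples_def algebra_simps)
  qed (use q in \<open>auto simp: chi_minus\<close>)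
  also have "\<dots> = (\<Sum>(a, b, c)\<in>simple_forms N. - (if odd b \<and> q dvd a then chi c else 0))"
    by (rule sum.mono_neutral_cong_left) (auto simp: finite_simple_forms dest: chi_even split: if_splits)
  finally show ?thesis by (simp add: case_prod_unfold sum_negf)
qed

lemma card_form_1_8_8:
  assumes "N mod 8 = 1" "N > 0"
  shows "int (card {(x, y, z). x\<^sup>2 + 8 * y\<^sup>2 + 8 * z\<^sup>2 = N}) = - 4 * odd_sum N + sqrt_count N"
proof -
  have "{(x, y, z). x\<^sup>2 + 8 * y\<^sup>2 + 8 * z\<^sup>2 = N} = {(x, y, z). x\<^sup>2 + 8 * (y\<^sup>2 + z\<^sup>2) = N}"
    by (auto simp: algebra_simps)
  then show ?thesis
    using card_ternary_sum2[of 8 N] sum_factor_triples_8[of N 1] assms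
    by (simp add: odd_sum_def)
qed

lemma even_if_sum_squares_mod_4: "(y\<^sup>2 + z\<^sup>2) mod 4 = 0 \<Longrightarrow> even y \<and> even z" for y z :: int
  using odd_square_mod_8[of y] odd_square_mod_8[of z] even_square_mod_4[of y] even_square_mod_4[of z]
  by (cases "odd y"; cases "odd z"; simp; presburger)

text \<open>Modulo 8, y and z must be even, so the form becomes x^2 + 56 (y^2 + z^2). For q = 7 the
  condition on a is the root (1 : 0).\<close>

lemma card_form_1_14_14:
  assumes N: "N mod 8 = 1" and "N > 0"
  shows "int (card {(x, y, z). x\<^sup>2 + 14 * y\<^sup>2 + 14 * z\<^sup>2 = N}) = 4 * odd_root_sum N 0 1 + sqrt_count N"
proof -
  have even: "even y \<and> even z" if "x\<^sup>2 + 14 * y\<^sup>2 + 14 * z\<^sup>2 = N" for x y z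
  proof -
    have "odd N" using N by presburger
    then have "odd (x\<^sup>2 + 14 * y\<^sup>2 + 14 * z\<^sup>2)" using that by simp
    then have "odd x" by simp
    then have "(y\<^sup>2 + z\<^sup>2) mod 4 = 0"
      using odd_square_mod_8[of x] that N by (simp; presburger)
    then show ?thesis by (rule even_if_sum_squares_mod_4)
  qed
  have "{(x, y, z). x\<^sup>2 + 14 * y\<^sup>2 + 14 * z\<^sup>2 = N}
      = (\<lambda>(x, y, z). (x, 2 * y, 2 * z)) ` {(x, y, z). x\<^sup>2 + 56 * (y\<^sup>2 + z\<^sup>2) = N}"
  proof (intro equalityI subsetI)
    fix p assume "p \<in> {(x, y, z). x\<^sup>2 + 14 * y\<^sup>2 + 14 * z\<^sup>2 = N}"
    then obtain x y z where p: "p = (x, y, z)" "x\<^sup>2 + 14 * y\<^sup>2 + 14 * z\<^sup>2 = N" by auto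
    obtain y' z' where "y = 2 * y'" "z = 2 * z'" using even[OF p(2)] by (auto elim!: evenE)
    then show "p \<in> (\<lambda>(x, y, z). (x, 2 * y, 2 * z)) ` {(x, y, z). x\<^sup>2 + 56 * (y\<^sup>2 + z\<^sup>2) = N}"
      using p by (intro image_eqI[of _ _ "(x, y', z')"]) (auto simp: power_mult_distrib)
  qed (auto simp: power_mult_distrib)
  then have "card {(x, y, z). x\<^sup>2 + 14 * y\<^sup>2 + 14 * z\<^sup>2 = N} = card {(x, y, z). x\<^sup>2 + 56 * (y\<^sup>2 + z\<^sup>2) = N}"
    by (simp add: card_image inj_on_def)
  moreover have "(\<Sum>(x, d, e)\<in>factor_triples 56 N. chi d) = - odd_root_sum N 1 0"
    using sum_factor_triples_8[OF N, of 7] by (simp add: odd_root_sum_def form_value_def)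
  ultimately show ?thesis using card_ternary_sum2[of 56 N] assms by (simp add: odd_root_sum_10)
qed

section \<open>Forms with b^2 - ac = 4N, and the form (2,7,14)\<close>

lemma mod_8_1_obtain:
  fixes n :: int
  assumes "n mod 8 = 1"
  obtains k where "n = 8 * k + 1"
  using mult_div_mod_eq[of 8 n] assms by metis

lemma chi_mod_8_5:
  fixes n :: int
  assumes "n mod 8 = 5"
  shows "chi n = 1"
proof -
  have "n mod 4 = 1" using assms by presburger
  then show ?thesis by (simp add: chi_def)
qed

lemma mod_8_5_cases:
  fixes a c :: int
  assumes "(a * c) mod 8 = 5"
  shows "odd a \<and> odd c \<and> 8 dvd c - 5 * a"
proof -
  have "8 dvd a * c - 5" using assms by (simp add: mod_eq_dvd_iff[symmetric])
  then obtain k where k: "a * c = 8 * k + 5" by (metis dvdE diff_eq_eq)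
  then have "odd (a * c)" by simp
  then have odd: "odd a" "odd c" by auto
  obtain j where j: "a\<^sup>2 = 8 * j + 1"
    using odd_square_mod_8[OF odd(1)] by (rule mod_8_1_obtain)
  have "c - 5 * a = a * (a * c) - 5 * a - (a\<^sup>2 - 1) * c"
    by (simp add: power2_eq_square algebra_simps)
  also have "\<dots> = 8 * (a * k - j * c)" unfolding k j by (simp add: algebra_simps)
  finally show ?thesis using odd by simp
qed

lemma odd_middle_mod_8:
  fixes a b c N :: int
  assumes "b\<^sup>2 - a * c = 4 * N" "odd b" "odd N"
  shows "(a * c) mod 8 = 5"
proof -
  have "b\<^sup>2 mod 8 = 1" by (rule odd_square_mod_8[OF assms(2)])
  then show ?thesis using assms(1,3) by presburger
qed

text \<open>The three-term relation at 4N with weight supported on even b and 8 | a. Such forms with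
  odd c are Q(2X, Y) with Q at level N, so two of the sums are odd root sums; the third sees half of
  the forms with odd b.\<close>

lemma sum_odd_middle_4:
  assumes N: "N mod 8 = 1"
  shows "(\<Sum>(a, b, c)\<in>simple_forms (4 * N). if odd b \<and> 7 dvd c then chi c else 0)
       = 2 * (odd_root_sum N 0 1 - odd_root_sum N 1 3 + boundary_sum (4 * N) 0 1)"
proof -
  have oN: "odd N" using N by presburger
  define u where "u a b c = (if even b \<and> 8 dvd a \<and> 7 dvd c then chi c else 0)" for a b c :: int
  have three: "(\<Sum>(a, b, c)\<in>simple_forms (4 * N). u a b c)
       = (\<Sum>(a, b, c)\<in>simple_forms (4 * N). u a (b - a) (a - 2 * b + c))
       + (\<Sum>(a, b, c)\<in>simple_forms (4 * N). u (a - 2 * b + c) (b - c) c)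
       - (\<Sum>(a, b, c)\<in>boundary_forms (4 * N). u a b c)"
  proof (rule sum_simple_three_term)
    show "u a b c = 0" if "a + 2 * b + c = 0" for a b c
    proof (cases "8 dvd a")
      case True
      then have "even c" using that by presburger
      then show ?thesis by (simp add: u_def chi_even)
    qed (simp add: u_def)
  qed (auto simp: u_def chi_minus chi_even)
  \<comment> \<open>Q(2X, Y) has coefficients (4a, 2b, c). The character removes even c, and for odd
    b and c at level N the condition 8 | 4a is automatic.\<close>
  have pullback: "(\<Sum>(a, b, c)\<in>simple_forms (4 * N). if even b \<and> 8 dvd a \<and> 7 dvd P a b c then chi c else 0)
      = odd_root_sum N x y"
    if P: "\<And>a b c. 7 dvd P (4 * a) (2 * b) c \<longleftrightarrow> 7 dvd form_value a b c x y" for P x y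
  proof -
    have "(\<Sum>(a, b, c)\<in>simple_forms (4 * N). if even b \<and> 8 dvd a \<and> 7 dvd P a b c then chi c else 0)
      = (\<Sum>(a, b, c)\<in>{(a, b, c) \<in> simple_forms (4 * N). even b \<and> 8 dvd a \<and> odd c \<and> 7 dvd P a b c}. chi c)"
      by (rule sum.mono_neutral_cong_right) (auto simp: finite_simple_forms dest: chi_even split: if_splits)
    also have "\<dots> = (\<Sum>(a, b, c)\<in>{(a, b, c) \<in> simple_forms N. odd b \<and> odd c \<and> 7 dvd form_value a b c x y}. chi c)"
    proof (rule sum.reindex_bij_witness[where i = "\<lambda>(a, b, c). (4 * a, 2 * b, c)" and j = "\<lambda>(a, b, c). (a div 4, b div 2, c)"])
      fix p assume "p \<in> {(a, b, c) \<in> simple_forms (4 * N). even b \<and> 8 dvd a \<and> odd c \<and> 7 dvd P a b c}"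
      then obtain a b c where p: "p = (a, b, c)" "b\<^sup>2 - a * c = 4 * N" "0 < a" "c < 0"
          "even b" "8 dvd a" "odd c" "7 dvd P a b c"
        by (auto simp: simple_forms_def)
      obtain a' where a': "a = 8 * a'" using p(6) by (rule dvdE)
      obtain b' where b': "b = 2 * b'" using p(5) by (rule evenE)
      have eq: "b'\<^sup>2 - (2 * a') * c = N" using p(2) by (simp add: a' b' power_mult_distrib)
      then have "odd (b'\<^sup>2 - (2 * a') * c)" using oN by simp
      then have "odd b'" by simp
      moreover have "7 dvd form_value (2 * a') b' c x y"
        using p(8) P[of "2 * a'" b' c] by (simp add: a' b')
      ultimately show "(case p of (a, b, c) \<Rightarrow> (a div 4, b div 2, c)) \<in> {(a, b, c) \<in> simple_forms N. odd b \<and> odd c \<and> 7 dvd form_value a b c x y}"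
        "(case case p of (a, b, c) \<Rightarrow> (a div 4, b div 2, c) of (a, b, c) \<Rightarrow> (4 * a, 2 * b, c)) = p"
        using p(1,3,4,7) eq by (simp_all add: simple_forms_def a' b')
    next
      fix p assume "p \<in> {(a, b, c) \<in> simple_forms N. odd b \<and> odd c \<and> 7 dvd form_value a b c x y}"
      then obtain a b c where p: "p = (a, b, c)" "b\<^sup>2 - a * c = N" "0 < a" "c < 0"
          "odd b" "odd c" "7 dvd form_value a b c x y"
        by (auto simp: simple_forms_def)
      have "8 dvd 4 * a" using odd_middle_dvd_8[OF p(2) N p(5,6)] by simp
      then show "(case p of (a, b, c) \<Rightarrow> (4 * a, 2 * b, c)) \<in> {(a, b, c) \<in> simple_forms (4 * N). even b \<and> 8 dvd a \<and> odd c \<and> 7 dvd P a b c}"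
        using p P by (auto simp: simple_forms_def power_mult_distrib)
    qed auto
    also have "\<dots> = odd_root_sum N x y" unfolding odd_root_sum_def
      by (rule sum.mono_neutral_cong_left) (auto simp: finite_simple_forms dest: chi_even split: if_splits)
    finally show ?thesis .
  qed
  have "(\<Sum>(a, b, c)\<in>simple_forms (4 * N). u a b c) = odd_root_sum N 0 1"
    unfolding u_def by (rule pullback[of "\<lambda>a b c. c"]) (simp add: form_value_def)
  \<comment> \<open>The root (1 : -1) of Q(2X, Y) is the root (2 : -1) of Q, which is (1 : 3) modulo
    7.\<close>
  moreover have "(\<Sum>(a, b, c)\<in>simple_forms (4 * N). u a (b - a) (a - 2 * b + c)) = odd_root_sum N 1 3"
  proof -
    have "(\<Sum>(a, b, c)\<in>simple_forms (4 * N). u a (b - a) (a - 2 * b + c))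
      = (\<Sum>(a, b, c)\<in>simple_forms (4 * N). if even b \<and> 8 dvd a \<and> 7 dvd a - 2 * b + c then chi c else 0)"
    proof (rule sum.cong, simp, clarify)
      fix a b c :: int
      show "u a (b - a) (a - 2 * b + c) = (if even b \<and> 8 dvd a \<and> 7 dvd a - 2 * b + c then chi c else 0)"
      proof (cases "even b \<and> 8 dvd a")
        case True
        then obtain a' b' where "a = 8 * a'" "b = 2 * b'" by (auto elim!: dvdE)
        then have "a - 2 * b + c = c + 4 * (2 * a' - b')" "even a" by simp_all
        then have "(a - 2 * b + c) mod 4 = c mod 4" "even a" by (simp_all only: mod_mult_self2)
        then show ?thesis using True chi_cong[of "a - 2 * b + c" c] by (simp add: u_def)
      next
        case False
        then have "\<not> (even (b - a) \<and> 8 dvd a)" by presburger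
        then show ?thesis using False by (auto simp: u_def)
      qed
    qed
    also have "\<dots> = odd_root_sum N 1 3"
    proof (rule pullback)
      fix a b c :: int
      have "4 * a - 2 * (2 * b) + c = 4 * form_value a b c 1 3 + 7 * (- 4 * b - 5 * c)"
        by (simp add: form_value_def)
      then have "7 dvd 4 * a - 2 * (2 * b) + c \<longleftrightarrow> 7 dvd 4 * form_value a b c 1 3"
        by (simp only: dvd_add_left_iff dvd_triv_left)
      moreover have "7 dvd 4 * n \<longleftrightarrow> 7 dvd n" for n :: int by presburger
      ultimately show "7 dvd 4 * a - 2 * (2 * b) + c \<longleftrightarrow> 7 dvd form_value a b c 1 3"
        by simp
    qed
    finally show ?thesis .
  qed
  moreover have "(\<Sum>(a, b, c)\<in>boundary_forms (4 * N). u a b c) = boundary_sum (4 * N) 0 1"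
    unfolding boundary_sum_def
  proof (rule sum.cong, simp, clarify)
    fix a b c assume "(a, b, c) \<in> boundary_forms (4 * N)"
    then have "a = 0" "even (b\<^sup>2)" by (auto simp: boundary_forms_def)
    then show "u a b c = (if 7 dvd form_value a b c 0 1 then chi c else 0)"
      by (simp add: u_def form_value_def)
  qed
  \<comment> \<open>For odd b, the numbers a - 2b + c and a + 2b + c are multiples of 4 differing by
    4b, so exactly one is divisible by 8; reflection makes the two halves equal.\<close>
  moreover have "(\<Sum>(a, b, c)\<in>simple_forms (4 * N). if odd b \<and> 7 dvd c then chi c else 0)
      = 2 * (\<Sum>(a, b, c)\<in>simple_forms (4 * N). u (a - 2 * b + c) (b - c) c)"
  proof -
    have "(\<Sum>(a, b, c)\<in>simple_forms (4 * N). u (a - 2 * b + c) (b - c) c)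
        + (\<Sum>(a, b, c)\<in>simple_forms (4 * N). u (a + 2 * b + c) (- b - c) c)
        = (\<Sum>(a, b, c)\<in>simple_forms (4 * N). if odd b \<and> 7 dvd c then chi c else 0)"
      unfolding sum.distrib[symmetric]
    proof (rule sum.cong, simp, clarify)
      fix a b c assume "(a, b, c) \<in> simple_forms (4 * N)"
      then have Q: "b\<^sup>2 - a * c = 4 * N" by (simp add: simple_forms_def)
      show "u (a - 2 * b + c) (b - c) c + u (a + 2 * b + c) (- b - c) c
          = (if odd b \<and> 7 dvd c then chi c else 0)"
      proof (cases "odd b")
        case True
        note m = mod_8_5_cases[OF odd_middle_mod_8[OF Q True oN]]
        obtain a' b' where ab: "a = 2 * a' + 1" "b = 2 * b' + 1" using m True by (auto elim!: oddE)
        obtain k where "c - 5 * a = 8 * k" using m by (auto elim: dvdE)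
        then have "a - 2 * b + c = 4 * (3 * a' - b' + 2 * k + 1)" "a + 2 * b + c = 4 * (3 * a' + b' + 2 * k + 2)"
          unfolding ab by simp_all
        moreover have "8 dvd 4 * n \<longleftrightarrow> even n" for n :: int by presburger
        moreover have "even (3 * a' - b' + 2 * k + 1) \<longleftrightarrow> \<not> even (3 * a' + b' + 2 * k + 2)" by simp
        ultimately have "8 dvd a - 2 * b + c \<longleftrightarrow> \<not> 8 dvd a + 2 * b + c" by (simp only:)
        then show ?thesis using True m by (auto simp: u_def)
      next
        case False
        then show ?thesis by (auto simp: u_def chi_even)
      qed
    qed
    moreover have "(\<Sum>(a, b, c)\<in>simple_forms (4 * N). u (a + 2 * b + c) (- b - c) c)
        = (\<Sum>(a, b, c)\<in>simple_forms (4 * N). u (a - 2 * b + c) (b - c) c)"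
      using sum_simple_reflect[of "\<lambda>a b c. u (a - 2 * b + c) (b - c) c" "4 * N"] by simp
    ultimately show ?thesis by simp
  qed
  ultimately show ?thesis using three by simp
qed

text \<open>As n is odd, exactly one coordinate of a sum of two squares is even, and by symmetry
  each is so in half of the cases.\<close>

lemma card_sum_square_four_square:
  assumes "n > 0" "n mod 8 = 5"
  shows "int (card {(c, b). c\<^sup>2 + 4 * b\<^sup>2 = n}) = 2 * dsum n"
proof -
  let ?A = "{(y, z). even z \<and> (y, z) \<in> sum2_reps n}" and ?B = "{(y, z). even y \<and> (y, z) \<in> sum2_reps n}"
  have one: "odd (y + z)" if "y\<^sup>2 + z\<^sup>2 = n" for y z
  proof -
    have "odd (y\<^sup>2 + z\<^sup>2)" unfolding that using assms(2) by presburger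
    then show ?thesis by simp
  qed
  have swap: "(z, y) \<in> sum2_reps n" if "(y, z) \<in> sum2_reps n" for y z
    using that by (simp add: sum2_reps_def add.commute)
  have fin: "finite ?A" "finite ?B"
    by (rule finite_subset[OF _ finite_sum2_reps[of n]]; auto)+
  have disj: "?A \<inter> ?B = {}" using one by (auto simp: sum2_reps_def)
  have un: "?A \<union> ?B = sum2_reps n" using one by (auto simp: sum2_reps_def)
  have "card (sum2_reps n) = card ?A + card ?B"
    by (rule card_Un_disjoint[OF fin disj, unfolded un])
  moreover have "bij_betw (\<lambda>(y, z). (z, y)) ?A ?B"
    by (rule bij_betw_byWitness[where f' = "\<lambda>(y, z). (z, y)"]) (auto intro: swap)
  then have "card ?B = card ?A" by (rule bij_betw_same_card[symmetric])
  moreover have "?A = (\<lambda>(c, b). (c, 2 * b)) ` {(c, b). c\<^sup>2 + 4 * b\<^sup>2 = n}"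
  proof (intro equalityI subsetI)
    fix p assume "p \<in> ?A"
    then obtain y z where p: "p = (y, z)" "even z" "y\<^sup>2 + z\<^sup>2 = n" by (auto simp: sum2_reps_def)
    then obtain b where "z = 2 * b" by (auto elim: evenE)
    then show "p \<in> (\<lambda>(c, b). (c, 2 * b)) ` {(c, b). c\<^sup>2 + 4 * b\<^sup>2 = n}"
      using p by (intro image_eqI[of _ _ "(y, b)"]) (simp_all add: power_mult_distrib)
  next
    fix p assume "p \<in> (\<lambda>(c, b). (c, 2 * b)) ` {(c, b). c\<^sup>2 + 4 * b\<^sup>2 = n}"
    then show "p \<in> ?A" by (auto simp: sum2_reps_def power_mult_distrib)
  qed
  then have "card ?A = card {(c, b). c\<^sup>2 + 4 * b\<^sup>2 = n}"
    by (simp only:) (rule card_image, auto simp: inj_on_def)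
  ultimately show ?thesis using card_sum2_reps[OF assms(1)] by simp
qed

text \<open>For odd x a value (4N - x^2) / 7 is 5 modulo 8, so
  \<open>card_sum_square_four_square\<close> applies; its divisors give the forms (d, x,
  -7e).\<close>

lemma card_odd_triples_7_28:
  fixes N :: int
  assumes N: "N mod 8 = 1"
  shows "int (card {(x, c, b). odd x \<and> x\<^sup>2 + 7 * c\<^sup>2 + 28 * b\<^sup>2 = 4 * N})
       = 2 * (\<Sum>(a, b, c)\<in>simple_forms (4 * N). if odd b \<and> 7 dvd c then chi c else 0)"
proof -
  have le: "x\<^sup>2 \<le> 4 * N" if "x\<^sup>2 + 7 * c\<^sup>2 + 28 * b\<^sup>2 = 4 * N" for x c b
    using that zero_le_power2[of b] zero_le_power2[of c] by linarith
  have div_neg_7: "- (7 * k) div 7 = - k" for k :: int by presburger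
  have oN: "odd N" using N by presburger
  have n5: "n mod 8 = 5" if h: "7 * n = 4 * N - x\<^sup>2" "x\<^sup>2 mod 8 = 1" for n x
  proof -
    obtain j where "N = 2 * j + 1" using oN by (rule oddE)
    moreover obtain k where "x\<^sup>2 = 8 * k + 1" using h(2) by (rule mod_8_1_obtain)
    ultimately have "n = 8 * (n - j + k - 1) + 5" using h(1) by simp
    then obtain t where "n = 8 * t + 5" by blast
    then show ?thesis by simp
  qed
  let ?n = "\<lambda>x. (4 * N - x\<^sup>2) div 7"
  let ?X = "{x. x\<^sup>2 < 4 * N \<and> 7 dvd 4 * N - x\<^sup>2}"
  let ?Y = "{x. x\<^sup>2 < 4 * N \<and> 7 dvd 4 * N - x\<^sup>2 \<and> odd x}"
  let ?R = "\<lambda>n. {(c, b). c\<^sup>2 + 4 * b\<^sup>2 = (n :: int)}"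
  have finR: "finite (?R n)" for n
  proof (rule finite_subset)
    show "?R n \<subseteq> {c. c\<^sup>2 \<le> n \<and> True} \<times> {b. b\<^sup>2 \<le> n \<and> True}"
    proof
      fix p assume "p \<in> ?R n"
      then obtain c b where p: "p = (c, b)" "c\<^sup>2 + 4 * b\<^sup>2 = n" by auto
      then have "c\<^sup>2 \<le> n" "b\<^sup>2 \<le> n" using zero_le_power2[of b] zero_le_power2[of c] by linarith+
      then show "p \<in> {c. c\<^sup>2 \<le> n \<and> True} \<times> {b. b\<^sup>2 \<le> n \<and> True}" using p(1) by simp
    qed
  qed (use finite_square_le[of n "\<lambda>_. True"] in simp)
  have n: "7 * ?n x = 4 * N - x\<^sup>2" if "x \<in> ?X" for x using that by simp
  have "{(x, c, b). odd x \<and> x\<^sup>2 + 7 * c\<^sup>2 + 28 * b\<^sup>2 = 4 * N} = Sigma ?Y (\<lambda>x. ?R (?n x))"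
  proof (intro equalityI subsetI)
    fix p assume "p \<in> {(x, c, b). odd x \<and> x\<^sup>2 + 7 * c\<^sup>2 + 28 * b\<^sup>2 = 4 * N}"
    then obtain x c b where p: "p = (x, c, b)" "odd x" "x\<^sup>2 + 7 * c\<^sup>2 + 28 * b\<^sup>2 = 4 * N" by auto
    then have e: "4 * N - x\<^sup>2 = 7 * (c\<^sup>2 + 4 * b\<^sup>2)" by simp
    have "x\<^sup>2 \<noteq> 4 * N" using odd_square_mod_8[OF p(2)] by presburger
    moreover have "x\<^sup>2 \<le> 4 * N" by (rule le[OF p(3)])
    ultimately have "x \<in> ?Y" "(c, b) \<in> ?R (?n x)" using p(2) e by auto
    then show "p \<in> Sigma ?Y (\<lambda>x. ?R (?n x))" unfolding p(1) by (rule SigmaI)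
  next
    fix p assume "p \<in> Sigma ?Y (\<lambda>x. ?R (?n x))"
    then obtain x c b where p: "p = (x, c, b)" "x \<in> ?Y" "c\<^sup>2 + 4 * b\<^sup>2 = ?n x" by auto
    then show "p \<in> {(x, c, b). odd x \<and> x\<^sup>2 + 7 * c\<^sup>2 + 28 * b\<^sup>2 = 4 * N}"
      using n[of x] by auto
  qed
  then have "int (card {(x, c, b). odd x \<and> x\<^sup>2 + 7 * c\<^sup>2 + 28 * b\<^sup>2 = 4 * N}) = (\<Sum>x\<in>?Y. int (card (?R (?n x))))"
    using finR by (simp add: card_SigmaI finite_square_less)
  also have "\<dots> = (\<Sum>x\<in>?Y. 2 * dsum (?n x))"
  proof (rule sum.cong)
    fix x assume x: "x \<in> ?Y"
    have "7 * ?n x = 4 * N - x\<^sup>2" using x n by simp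
    moreover have "x\<^sup>2 mod 8 = 1" using x odd_square_mod_8 by simp
    ultimately have "?n x mod 8 = 5" by (rule n5)
    moreover have "0 < 7 * ?n x" using x n[of x] by simp
    then have "0 < ?n x" by simp
    ultimately show "int (card (?R (?n x))) = 2 * dsum (?n x)" by (rule card_sum_square_four_square[rotated])
  qed simp
  also have "\<dots> = (\<Sum>x\<in>?X. (if odd x then 2 else 0) * dsum (?n x))"
    by (rule sum.mono_neutral_cong_left) (auto simp: finite_square_less)
  also have "\<dots> = (\<Sum>(x, d, e)\<in>factor_triples 7 (4 * N). (if odd x then 2 else 0) * chi d)"
    by (rule sum_factor_triples[symmetric]) simp
  also have "\<dots> = (\<Sum>(x, d, e)\<in>{(x, d, e) \<in> factor_triples 7 (4 * N). odd x}. 2 * chi d)"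
    by (rule sum.mono_neutral_cong_right) (auto simp: finite_factor_triples)
  also have "\<dots> = (\<Sum>(a, b, c)\<in>{(a, b, c) \<in> simple_forms (4 * N). odd b \<and> 7 dvd c}. 2 * chi c)"
  proof (rule sum.reindex_bij_witness[where j = "\<lambda>(x, d, e). (d, x, - 7 * e)" and i = "\<lambda>(a, b, c). (b, a, - c div 7)"])
    fix p assume "p \<in> {(x, d, e) \<in> factor_triples 7 (4 * N). odd x}"
    then obtain x d e where p: "p = (x, d, e)" "x\<^sup>2 + 7 * (d * e) = 4 * N" "0 < d" "0 < e" "odd x"
      by (auto simp: factor_triples_def)
    \<comment> \<open>The product ac is 5 modulo 8, so the character agrees at a and c.\<close>
    have "x\<^sup>2 - d * (- 7 * e) = 4 * N" using p(2) by simp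
    then have "(d * (- 7 * e)) mod 8 = 5" by (rule odd_middle_mod_8) (use p(5) oN in auto)
    then have "chi (d * (- 7 * e)) = 1" by (rule chi_mod_8_5)
    then have "chi d * chi (- 7 * e) = 1" by (simp only: chi_mult)
    then have "chi d = chi (- 7 * e)" by (metis zmult_eq_1_iff)
    then show "(case case p of (x, d, e) \<Rightarrow> (d, x, - 7 * e) of (a, b, c) \<Rightarrow> 2 * chi c)
        = (case p of (x, d, e) \<Rightarrow> 2 * chi d)" using p(1) by simp
  qed (auto simp: factor_triples_def simple_forms_def div_neg_7 elim!: dvdE[where b = 7])
  also have "\<dots> = (\<Sum>(a, b, c)\<in>simple_forms (4 * N). 2 * (if odd b \<and> 7 dvd c then chi c else 0))"
    by (rule sum.mono_neutral_cong_left) (auto simp: finite_simple_forms split: if_splits)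
  finally show ?thesis by (simp add: case_prod_unfold sum_distrib_left)
qed

text \<open>
  The first of the two maps is multiplication of \<open>x + z \<surd>(-7)\<close> by \<open>1 + \<surd>(-7)\<close>, twice a
  generator of a prime above 2; the second is its composition with conjugation.
\<close>
lemma card_form_2_7_14:
  fixes N :: int
  assumes N: "N mod 8 = 1"
  shows "2 * card {(x, y, z). 2 * x\<^sup>2 + 7 * y\<^sup>2 + 14 * z\<^sup>2 = N}
       = card {(x, c, b). odd x \<and> x\<^sup>2 + 7 * c\<^sup>2 + 28 * b\<^sup>2 = 4 * N}"
proof -
  let ?S = "{(x, y, z). 2 * x\<^sup>2 + 7 * y\<^sup>2 + 14 * z\<^sup>2 = N}"
  let ?T = "{(x, c, b). odd x \<and> x\<^sup>2 + 7 * c\<^sup>2 + 28 * b\<^sup>2 = 4 * N}"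
  let ?f = "\<lambda>(x, y, z). (x - 7 * z, x + z, y) :: int \<times> int \<times> int"
  let ?g = "\<lambda>(x, y, z). (x - 7 * z, - x - z, y) :: int \<times> int \<times> int"
  have oN: "odd N" using N by presburger
  have par: "odd (x - 7 * z) \<and> odd (x + z)" if "2 * x\<^sup>2 + 7 * y\<^sup>2 + 14 * z\<^sup>2 = N" for x y z
  proof -
    have "odd (2 * x\<^sup>2 + 7 * y\<^sup>2 + 14 * z\<^sup>2)" unfolding that by (rule oN)
    then have "y\<^sup>2 mod 8 = 1" by (intro odd_square_mod_8) simp
    then obtain k where "y\<^sup>2 = 8 * k + 1" by (rule mod_8_1_obtain)
    moreover obtain j where "N = 8 * j + 1" using N by (rule mod_8_1_obtain)
    ultimately have "x\<^sup>2 + 7 * z\<^sup>2 = 1 + 4 * (j - 7 * k - 1)" using that by simp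
    then have "odd (x\<^sup>2 + 7 * z\<^sup>2)" by (simp only: even_add even_mult_iff) simp
    then show ?thesis by simp
  qed
  \<comment> \<open>This decides which of the two maps reaches (x, c, b). The squares x^2 and c^2
    agree modulo 16, and (x - c) / 2 and (x + c) / 2 differ by the odd c, so 4 divides one of
    them.\<close>
  have dvd8: "8 dvd x - c \<or> 8 dvd x + c" and oc: "odd c"
    if xc: "odd x" "x\<^sup>2 + 7 * c\<^sup>2 + 28 * b\<^sup>2 = 4 * N" for x c b
  proof -
    have "odd (x\<^sup>2 + 7 * c\<^sup>2 + 28 * b\<^sup>2) \<longleftrightarrow> odd (x\<^sup>2 + c\<^sup>2)" by simp
    then have "even (x\<^sup>2 + c\<^sup>2)" unfolding xc(2) by simp
    then show oc: "odd c" using xc(1) by simp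
    have 1: "x\<^sup>2 mod 8 = 1" "c\<^sup>2 mod 8 = 1" using odd_square_mod_8 xc(1) oc by blast+
    have ob: "odd b"
    proof
      assume "even b"
      then obtain j where "b = 2 * j" by (rule evenE)
      moreover obtain k where "x\<^sup>2 = 8 * k + 1" using 1(1) by (rule mod_8_1_obtain)
      moreover obtain l where "c\<^sup>2 = 8 * l + 1" using 1(2) by (rule mod_8_1_obtain)
      moreover obtain m where "N = 8 * m + 1" using N by (rule mod_8_1_obtain)
      ultimately have "2 * (k + 7 * l + 14 * j\<^sup>2 - 4 * m + 1) = 1"
        using xc(2) by (simp add: power_mult_distrib)
      then have "(2 :: int) dvd 1" by (metis dvd_triv_left)
      then show False by simp
    qed
    then have "b\<^sup>2 mod 8 = 1" by (rule odd_square_mod_8)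
    then obtain \<beta> where \<beta>: "b\<^sup>2 = 8 * \<beta> + 1" by (rule mod_8_1_obtain)
    obtain \<gamma> where \<gamma>: "c\<^sup>2 = 8 * \<gamma> + 1" using 1(2) by (rule mod_8_1_obtain)
    obtain \<nu> where \<nu>: "N = 8 * \<nu> + 1" using N by (rule mod_8_1_obtain)
    have "x\<^sup>2 = 4 * N - 7 * c\<^sup>2 - 28 * b\<^sup>2" using xc(2) by simp
    then have "x\<^sup>2 - c\<^sup>2 = 16 * (2 * \<nu> - 4 * \<gamma> - 14 * \<beta> - 2)"
      unfolding \<beta> \<gamma> \<nu> by simp
    then have "16 dvd x\<^sup>2 - c\<^sup>2" by simp
    moreover have "x\<^sup>2 - c\<^sup>2 = (x - c) * (x + c)" by (simp add: power2_eq_square algebra_simps)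
    ultimately have d: "16 dvd (x - c) * (x + c)" by simp
    have "even (x - c)" using xc(1) oc by simp
    then obtain h where h: "x - c = 2 * h" by (rule evenE)
    then have "(x - c) * (x + c) = 4 * (h * (h + c))" by (simp add: algebra_simps)
    with d have "16 dvd 4 * (h * (h + c))" by simp
    then have "4 dvd h * (h + c)" by presburger
    moreover have "odd h \<or> odd (h + c)" using oc by simp
    then have "coprime 4 h \<or> coprime 4 (h + c)"
      using coprime_power_left_iff[of 2 2 h] coprime_power_left_iff[of 2 2 "h + c"] by auto
    ultimately have "4 dvd h \<or> 4 dvd h + c"
      by (auto simp: coprime_dvd_mult_left_iff coprime_dvd_mult_right_iff)
    then show "8 dvd x - c \<or> 8 dvd x + c" using h by presburger
  qed
  have eqf: "(x - 7 * z)\<^sup>2 + 7 * (x + z)\<^sup>2 + 28 * y\<^sup>2 = 4 * (2 * x\<^sup>2 + 7 * y\<^sup>2 + 14 * z\<^sup>2)" for x y z :: int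
    by (simp add: power2_eq_square algebra_simps)
  have neg: "(- x - z)\<^sup>2 = (x + z)\<^sup>2" for x z :: int
    by (simp add: power2_eq_square algebra_simps)
  have T: "?T = ?f ` ?S \<union> ?g ` ?S"
  proof (intro equalityI subsetI)
    fix p assume "p \<in> ?T"
    then obtain x c b where p: "p = (x, c, b)" "odd x" "x\<^sup>2 + 7 * c\<^sup>2 + 28 * b\<^sup>2 = 4 * N" by auto
    from dvd8[OF p(2,3)] show "p \<in> ?f ` ?S \<union> ?g ` ?S"
    proof
      assume "8 dvd x - c"
      then obtain z where z: "x - c = 8 * z" by (rule dvdE)
      have e: "c + z - 7 * (- z) = x" "c + z + - z = c" using z by simp_all
      have "4 * (2 * (c + z)\<^sup>2 + 7 * b\<^sup>2 + 14 * (- z)\<^sup>2) = 4 * N"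
        using eqf[of "c + z" "- z" b, unfolded e] p(3) by simp
      then have "(c + z, b, - z) \<in> ?S" by simp
      moreover have "p = ?f (c + z, b, - z)" using p(1) z by simp
      ultimately show ?thesis by blast
    next
      assume "8 dvd x + c"
      then obtain z where z: "x + c = 8 * z" by (rule dvdE)
      have e: "z - c - 7 * (- z) = x" "z - c + - z = - c" using z by simp_all
      have "4 * (2 * (z - c)\<^sup>2 + 7 * b\<^sup>2 + 14 * (- z)\<^sup>2) = 4 * N"
        using eqf[of "z - c" "- z" b, unfolded e] p(3) by simp
      then have "(z - c, b, - z) \<in> ?S" by simp
      moreover have "p = ?g (z - c, b, - z)" using p(1) z by simp
      ultimately show ?thesis by blast
    qed
  next
    fix p assume "p \<in> ?f ` ?S \<union> ?g ` ?S"
    then obtain x y z where p: "p = (x - 7 * z, x + z, y) \<or> p = (x - 7 * z, - x - z, y)"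
        and xyz: "2 * x\<^sup>2 + 7 * y\<^sup>2 + 14 * z\<^sup>2 = N"
      by auto
    have "odd (x - 7 * z)" using par[OF xyz] by (rule conjunct1)
    moreover have "(x - 7 * z)\<^sup>2 + 7 * (x + z)\<^sup>2 + 28 * y\<^sup>2 = 4 * N" unfolding eqf xyz ..
    ultimately show "p \<in> ?T" using p by (elim disjE) (simp_all only: neg mem_Collect_eq prod.case simp_thms)
  qed
  \<comment> \<open>A common image would give x + z = 4 (z - z'), but x + z is odd.\<close>
  have disj: "?f ` ?S \<inter> ?g ` ?S = {}"
  proof (rule equals0I)
    fix p assume p: "p \<in> ?f ` ?S \<inter> ?g ` ?S"
    from IntD1[OF p] obtain x y z where xyz: "2 * x\<^sup>2 + 7 * y\<^sup>2 + 14 * z\<^sup>2 = N" "p = (x - 7 * z, x + z, y)"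
      by auto
    from IntD2[OF p] obtain x' y' z' where "p = (x' - 7 * z', - x' - z', y')"
      by auto
    with xyz(2) have "x - 7 * z = x' - 7 * z'" "x + z = - x' - z'" by auto
    then have "x + z = 2 * (2 * (z - z'))" by simp
    then have "even (x + z)" by (rule dvdI)
    then show False using par[OF xyz(1)] by blast
  qed
  have finS: "finite ?S"
  proof (rule finite_subset)
    show "?S \<subseteq> {x. x\<^sup>2 \<le> N \<and> True} \<times> {x. x\<^sup>2 \<le> N \<and> True} \<times> {x. x\<^sup>2 \<le> N \<and> True}"
    proof
      fix p assume "p \<in> ?S"
      then obtain x y z where p: "p = (x, y, z)" "2 * x\<^sup>2 + 7 * y\<^sup>2 + 14 * z\<^sup>2 = N" by auto
      then have "x\<^sup>2 \<le> N" "y\<^sup>2 \<le> N" "z\<^sup>2 \<le> N"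
        using zero_le_power2[of x] zero_le_power2[of y] zero_le_power2[of z] by linarith+
      then show "p \<in> {x. x\<^sup>2 \<le> N \<and> True} \<times> {x. x\<^sup>2 \<le> N \<and> True} \<times> {x. x\<^sup>2 \<le> N \<and> True}"
        using p(1) by simp
    qed
  qed (use finite_square_le[of N "\<lambda>_. True"] in simp)
  have "card (?f ` ?S) = card ?S" "card (?g ` ?S) = card ?S"
    by (rule card_image, auto simp: inj_on_def)+
  then show ?thesis unfolding T using finS disj by (simp add: card_Un_disjoint)
qed

section \<open>The form (3,5,14)\<close>

text \<open>
  The vectors \<open>(1, \<plusminus>2, \<plusminus>3)\<close> and \<open>(1, \<plusminus>3, \<plusminus>2)\<close> span the eight isotropic lines of
  \<open>x\<^sup>2 + 8 y\<^sup>2 + 8 z\<^sup>2\<close> modulo 7.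
\<close>

definition line_count :: "int \<Rightarrow> int \<Rightarrow> int \<Rightarrow> int" where
  "line_count x y z =
     of_bool (7 dvd x + 2 * y + 3 * z) + of_bool (7 dvd x + 2 * y + (- 3) * z)
   + of_bool (7 dvd x + (- 2) * y + 3 * z) + of_bool (7 dvd x + (- 2) * y + (- 3) * z)
   + of_bool (7 dvd x + 3 * y + 2 * z) + of_bool (7 dvd x + 3 * y + (- 2) * z)
   + of_bool (7 dvd x + (- 3) * y + 2 * z) + of_bool (7 dvd x + (- 3) * y + (- 2) * z)"

text \<open>A nonzero isotropic vector is orthogonal only to its own line. For norm n nonzero, the
  orthogonal plane has two isotropic lines if -n is a square modulo 7 and none otherwise, and -1 is
  not a square.\<close>

lemma line_count_eq:
  "line_count x y z =
    (if 7 dvd x \<and> 7 dvd y \<and> 7 dvd z then 8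
     else if 7 dvd x\<^sup>2 + 8 * y\<^sup>2 + 8 * z\<^sup>2 then 1
     else if (x\<^sup>2 + 8 * y\<^sup>2 + 8 * z\<^sup>2) mod 7 \<in> {1, 2, 4} then 0 else 2)"
proof -
  define r s t where "r = x mod 7" and "s = y mod 7" and "t = z mod 7"
  have all: "\<forall>r\<in>set [0..6]. \<forall>s\<in>set [0..6]. \<forall>t\<in>set [0..6].
     of_bool ((r + 2 * s + 3 * t) mod 7 = 0) + of_bool ((r + 2 * s + (- 3) * t) mod 7 = 0)
   + of_bool ((r + (- 2) * s + 3 * t) mod 7 = 0) + of_bool ((r + (- 2) * s + (- 3) * t) mod 7 = 0)
   + of_bool ((r + 3 * s + 2 * t) mod 7 = 0) + of_bool ((r + 3 * s + (- 2) * t) mod 7 = 0)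
   + of_bool ((r + (- 3) * s + 2 * t) mod 7 = 0) + of_bool ((r + (- 3) * s + (- 2) * t) mod 7 = 0) =
    (if r = 0 \<and> s = 0 \<and> t = 0 then 8
     else if (r * r + 8 * (s * s) + 8 * (t * t)) mod 7 = 0 then 1
     else if (r * r + 8 * (s * s) + 8 * (t * t)) mod 7 \<in> {1, 2, 4} then 0 else (2 :: int))"
    by code_simp
  have mem: "n mod 7 \<in> set [0..6]" for n :: int
    using pos_mod_bound[of 7 n] by simp
  have val: "7 dvd x + p * y + q * z \<longleftrightarrow> (r + p * s + q * t) mod 7 = 0" for p q
  proof -
    have "(x + p * y + q * z) mod 7 = (r + p * s + q * t) mod 7"
      unfolding r_def s_def t_def by (intro mod_add_cong mod_mult_cong) auto
    then show ?thesis by (simp add: dvd_eq_mod_eq_0)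
  qed
  have norm: "(x\<^sup>2 + 8 * y\<^sup>2 + 8 * z\<^sup>2) mod 7 = (r * r + 8 * (s * s) + 8 * (t * t)) mod 7"
    unfolding power2_eq_square r_def s_def t_def by (intro mod_add_cong mod_mult_cong) auto
  have "line_count x y z = (if r = 0 \<and> s = 0 \<and> t = 0 then 8
     else if (r * r + 8 * (s * s) + 8 * (t * t)) mod 7 = 0 then 1
     else if (r * r + 8 * (s * s) + 8 * (t * t)) mod 7 \<in> {1, 2, 4} then 0 else 2)"
    unfolding line_count_def val by (rule all[rule_format]) (simp_all only: r_def s_def t_def mem)
  then show ?thesis
    unfolding dvd_eq_mod_eq_0 norm r_def s_def t_def .
qed

section \<open>Representations orthogonal to an isotropic line\<close>

definition reps_1_8_8 :: "int \<Rightarrow> (int \<times> int \<times> int) set" where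
  "reps_1_8_8 N = {(x, y, z). x\<^sup>2 + 8 * y\<^sup>2 + 8 * z\<^sup>2 = N}"

text \<open>As 8 is 1 modulo 7, the congruence is orthogonality to (1, p, q).\<close>

definition line_reps :: "int \<Rightarrow> int \<Rightarrow> int \<Rightarrow> (int \<times> int \<times> int) set" where
  "line_reps N p q = {(x, y, z). x\<^sup>2 + 8 * y\<^sup>2 + 8 * z\<^sup>2 = N \<and> 7 dvd x + p * y + q * z}"

lemma finite_reps_1_8_8: "finite (reps_1_8_8 N)"
proof (rule finite_subset)
  show "reps_1_8_8 N \<subseteq> {x. x\<^sup>2 \<le> N \<and> True} \<times> {x. x\<^sup>2 \<le> N \<and> True} \<times> {x. x\<^sup>2 \<le> N \<and> True}"
  proof
    fix p assume "p \<in> reps_1_8_8 N"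
    then obtain x y z where p: "p = (x, y, z)" "x\<^sup>2 + 8 * y\<^sup>2 + 8 * z\<^sup>2 = N" by (auto simp: reps_1_8_8_def)
    then have "x\<^sup>2 \<le> N" "y\<^sup>2 \<le> N" "z\<^sup>2 \<le> N"
      using zero_le_power2[of x] zero_le_power2[of y] zero_le_power2[of z] by linarith+
    then show "p \<in> {x. x\<^sup>2 \<le> N \<and> True} \<times> {x. x\<^sup>2 \<le> N \<and> True} \<times> {x. x\<^sup>2 \<le> N \<and> True}"
      using p(1) by simp
  qed
qed (use finite_square_le[of N "\<lambda>_. True"] in simp)

lemma card_line_reps_neg_left: "card (line_reps N (- p) q) = card (line_reps N p q)"
  by (rule bij_betw_same_card[of "\<lambda>(x, y, z). (x, - y, z)"],
      rule bij_betw_byWitness[where f' = "\<lambda>(x, y, z). (x, - y, z)"])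
     (auto simp: line_reps_def)

lemma card_line_reps_neg_right: "card (line_reps N p (- q)) = card (line_reps N p q)"
  by (rule bij_betw_same_card[of "\<lambda>(x, y, z). (x, y, - z)"],
      rule bij_betw_byWitness[where f' = "\<lambda>(x, y, z). (x, y, - z)"])
     (auto simp: line_reps_def)

lemma card_line_reps_swap: "card (line_reps N q p) = card (line_reps N p q)"
  by (rule bij_betw_same_card[of "\<lambda>(x, y, z). (x, z, y)"],
      rule bij_betw_byWitness[where f' = "\<lambda>(x, y, z). (x, z, y)"])
     (auto simp: line_reps_def algebra_simps)

lemma card_line_reps_eq_sum:
  "int (card (line_reps N p q)) = (\<Sum>(x, y, z)\<in>reps_1_8_8 N. of_bool (7 dvd x + p * y + q * z))"
proof -
  define P where "P v = (case v of (x, y, z) \<Rightarrow> 7 dvd x + p * y + q * z)" for v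
  have "line_reps N p q = reps_1_8_8 N \<inter> {v. P v}"
    by (auto simp: line_reps_def reps_1_8_8_def P_def)
  then have "int (card (line_reps N p q)) = (\<Sum>v\<in>reps_1_8_8 N. of_bool (P v))"
    by (simp add: sum_of_bool_eq finite_reps_1_8_8)
  also have "\<dots> = (\<Sum>(x, y, z)\<in>reps_1_8_8 N. of_bool (7 dvd x + p * y + q * z))"
    by (rule sum.cong) (auto simp: P_def)
  finally show ?thesis .
qed

text \<open>Sign changes and the exchange of y and z preserve the form and permute the eight lines
  transitively.\<close>

lemma sum_line_count:
  "(\<Sum>(x, y, z)\<in>reps_1_8_8 N. line_count x y z) = 8 * int (card (line_reps N 2 3))"
proof -
  have "(\<Sum>(x, y, z)\<in>reps_1_8_8 N. line_count x y z)
     = int (card (line_reps N 2 3)) + int (card (line_reps N 2 (- 3)))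
     + int (card (line_reps N (- 2) 3)) + int (card (line_reps N (- 2) (- 3)))
     + int (card (line_reps N 3 2)) + int (card (line_reps N 3 (- 2)))
     + int (card (line_reps N (- 3) 2)) + int (card (line_reps N (- 3) (- 2)))"
    unfolding card_line_reps_eq_sum sum.distrib[symmetric]
    by (rule sum.cong) (auto simp: line_count_def)
  then show ?thesis
    by (simp add: card_line_reps_neg_left card_line_reps_neg_right card_line_reps_swap[of N 3 2])
qed

lemma card_reps_1_8_8_multiples_7:
  "card {(x, y, z) \<in> reps_1_8_8 N. 7 dvd x \<and> 7 dvd y \<and> 7 dvd z}
   = (if 49 dvd N then card (reps_1_8_8 (N div 49)) else 0)"
proof (cases "49 dvd N")
  case True
  then obtain K where K: "N = 49 * K" by (rule dvdE)
  have "{(x, y, z) \<in> reps_1_8_8 N. 7 dvd x \<and> 7 dvd y \<and> 7 dvd z}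
      = (\<lambda>(x, y, z). (7 * x, 7 * y, 7 * z)) ` reps_1_8_8 K"
  proof (intro equalityI subsetI)
    fix p assume "p \<in> {(x, y, z) \<in> reps_1_8_8 N. 7 dvd x \<and> 7 dvd y \<and> 7 dvd z}"
    then obtain x y z where p: "p = (7 * x, 7 * y, 7 * z)" "(7 * x)\<^sup>2 + 8 * (7 * y)\<^sup>2 + 8 * (7 * z)\<^sup>2 = N"
      by (auto simp: reps_1_8_8_def elim!: dvdE)
    then have "x\<^sup>2 + 8 * y\<^sup>2 + 8 * z\<^sup>2 = K" by (simp add: K power_mult_distrib)
    then show "p \<in> (\<lambda>(x, y, z). (7 * x, 7 * y, 7 * z)) ` reps_1_8_8 K"
      using p(1) by (intro image_eqI[of _ _ "(x, y, z)"]) (simp_all add: reps_1_8_8_def)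
  qed (auto simp: reps_1_8_8_def K power_mult_distrib)
  moreover have "inj_on (\<lambda>(x, y, z). (7 * x, 7 * y, 7 * z :: int)) (reps_1_8_8 K)"
    by (auto simp: inj_on_def)
  ultimately have "card {(x, y, z) \<in> reps_1_8_8 N. 7 dvd x \<and> 7 dvd y \<and> 7 dvd z} = card (reps_1_8_8 K)"
    by (simp only: card_image)
  then show ?thesis using K by simp
next
  case False
  have "49 dvd N" if h: "x\<^sup>2 + 8 * y\<^sup>2 + 8 * z\<^sup>2 = N" "7 dvd x" "7 dvd y" "7 dvd z" for x y z
  proof -
    obtain x' y' z' where "x = 7 * x'" "y = 7 * y'" "z = 7 * z'"
      using h(2-4) by (auto elim!: dvdE)
    then have "N = 49 * (x'\<^sup>2 + 8 * y'\<^sup>2 + 8 * z'\<^sup>2)" using h(1) by (simp add: power_mult_distrib)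
    then show ?thesis by simp
  qed
  then have "{(x, y, z) \<in> reps_1_8_8 N. 7 dvd x \<and> 7 dvd y \<and> 7 dvd z} = {}"
    using False by (auto simp: reps_1_8_8_def)
  then show ?thesis using False by (simp only: card.empty if_False)
qed

text \<open>Sum \<open>line_count_eq\<close> over all representations. If 7 divides N, vectors
  divisible by 7 count 8 = 1 + 7, and they come from N / 49.\<close>

lemma card_line_reps:
  "8 * int (card (line_reps N 2 3)) =
    (if 7 dvd N then int (card (reps_1_8_8 N)) + (if 49 dvd N then 7 * int (card (reps_1_8_8 (N div 49))) else 0)
     else if N mod 7 \<in> {1, 2, 4} then 0 else 2 * int (card (reps_1_8_8 N)))"
proof (cases "7 dvd N")
  case True
  let ?P = "\<lambda>v. case v of (x, y, z) \<Rightarrow> (7 :: int) dvd x \<and> 7 dvd y \<and> (7 :: int) dvd (z :: int)"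
  have "(\<Sum>(x, y, z)\<in>reps_1_8_8 N. line_count x y z) = (\<Sum>v\<in>reps_1_8_8 N. 1 + 7 * of_bool (?P v))"
  proof (rule sum.cong[OF refl])
    fix v assume "v \<in> reps_1_8_8 N"
    then obtain x y z where v: "v = (x, y, z)" "x\<^sup>2 + 8 * y\<^sup>2 + 8 * z\<^sup>2 = N"
      by (auto simp: reps_1_8_8_def)
    show "(case v of (x, y, z) \<Rightarrow> line_count x y z) = 1 + 7 * of_bool (?P v)"
      unfolding v(1) prod.case line_count_eq v(2) using True by simp
  qed
  also have "\<dots> = int (card (reps_1_8_8 N)) + 7 * int (card (reps_1_8_8 N \<inter> {v. ?P v}))"
    by (simp add: sum.distrib sum_distrib_left[symmetric] sum_of_bool_eq finite_reps_1_8_8)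
  also have "reps_1_8_8 N \<inter> {v. ?P v} = {(x, y, z) \<in> reps_1_8_8 N. 7 dvd x \<and> 7 dvd y \<and> 7 dvd z}"
    by auto
  finally show ?thesis using True by (simp add: sum_line_count card_reps_1_8_8_multiples_7)
next
  case False
  have "(\<Sum>(x, y, z)\<in>reps_1_8_8 N. line_count x y z)
      = (\<Sum>v\<in>reps_1_8_8 N. if N mod 7 \<in> {1, 2, 4} then 0 else 2)"
  proof (rule sum.cong[OF refl])
    fix v assume "v \<in> reps_1_8_8 N"
    then obtain x y z where v: "v = (x, y, z)" "x\<^sup>2 + 8 * y\<^sup>2 + 8 * z\<^sup>2 = N"
      by (auto simp: reps_1_8_8_def)
    then have "\<not> (7 dvd x \<and> 7 dvd y \<and> 7 dvd z)" using False by (auto simp: power2_eq_square)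
    then show "(case v of (x, y, z) \<Rightarrow> line_count x y z) = (if N mod 7 \<in> {1, 2, 4} then 0 else 2)"
      unfolding v(1) prod.case line_count_eq v(2) using False by (simp only: if_False)
  qed
  then show ?thesis using False by (simp add: sum_line_count)
qed

section \<open>The lattice of (3,5,14)\<close>

lemma form_3_5_14_parity:
  fixes x y z N :: int
  assumes N: "N mod 8 = 1" and xyz: "3 * x\<^sup>2 + 5 * y\<^sup>2 + 14 * z\<^sup>2 + 2 * x * y = N"
  shows "even y \<and> even (z - x)"
proof -
  obtain n where n: "N = 8 * n + 1" using N by (rule mod_8_1_obtain)
  have "odd (3 * x\<^sup>2 + 5 * y\<^sup>2 + 14 * z\<^sup>2 + 2 * x * y)" unfolding xyz n by simp
  then have xy: "odd (x + y)" by simp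
  have ev: "even (w * (k * w + t))" if "odd k" "odd t" for w k t :: int
    using that by auto
  \<comment> \<open>For even x, y is odd and 7 z^2 would be 2 modulo 4.\<close>
  have "odd x"
  proof
    assume "even x"
    then obtain w where w: "x = 2 * w" by (rule evenE)
    have oy: "odd y" using xy \<open>even x\<close> by simp
    then obtain m where m: "y\<^sup>2 = 8 * m + 1" using odd_square_mod_8 mod_8_1_obtain by metis
    have "even (w * (3 * w + y))" by (rule ev) (use oy in simp_all)
    then obtain q where q: "w * (3 * w + y) = 2 * q" by (rule evenE)
    have "3 * x\<^sup>2 + 2 * x * y = 4 * (w * (3 * w + y))"
      by (simp add: w power2_eq_square algebra_simps)
    then have "14 * z\<^sup>2 = 2 * (4 * (n - 5 * m - q) - 2)" using xyz unfolding q m n by simp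
    then have z2: "7 * z\<^sup>2 = 4 * (n - 5 * m - q) - 2" by simp
    then have "even (7 * z\<^sup>2)" by simp
    then have "even z" by simp
    then obtain t where "z = 2 * t" by (rule evenE)
    with z2 have "2 * (n - 5 * m - q - 7 * t\<^sup>2) = 1" by (simp add: power_mult_distrib)
    then have "(2 :: int) dvd 1" by (metis dvd_triv_left)
    then show False by simp
  qed
  then have "even y" using xy by simp
  then obtain w where w: "y = 2 * w" by (rule evenE)
  obtain m where m: "x\<^sup>2 = 8 * m + 1" using \<open>odd x\<close> odd_square_mod_8 mod_8_1_obtain by metis
  have "even (w * (5 * w + x))" by (rule ev) (use \<open>odd x\<close> in simp_all)
  then obtain q where q: "w * (5 * w + x) = 2 * q" by (rule evenE)
  have "5 * y\<^sup>2 + 2 * x * y = 4 * (w * (5 * w + x))"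
    by (simp add: w power2_eq_square algebra_simps)
  then have "14 * z\<^sup>2 = 2 * (4 * (n - 3 * m - q) - 1)" using xyz unfolding q m n by simp
  then have "7 * z\<^sup>2 = 4 * (n - 3 * m - q) - 1" by simp
  then have "odd (7 * z\<^sup>2)" by simp
  then have "odd z" by simp
  with \<open>odd x\<close> \<open>even y\<close> show ?thesis by simp
qed

text \<open>Both sets are parametrised by the same (y, z, t), where 7t = x + 2y + 3z on the side of
  the line. The map \<open>?g\<close> carries one form to the other; its image is cut out by the
  parity conditions of \<open>form_3_5_14_parity\<close>.\<close>

lemma card_form_3_5_14:
  fixes N :: int
  assumes N: "N mod 8 = 1"
  shows "card {(x, y, z). 3 * x\<^sup>2 + 5 * y\<^sup>2 + 14 * z\<^sup>2 + 2 * x * y = N} = card (line_reps N 2 3)"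
proof -
  let ?P = "{(y, z, t). (7 * t - 2 * y - 3 * z)\<^sup>2 + 8 * y\<^sup>2 + 8 * z\<^sup>2 = N}"
  let ?f = "\<lambda>(y, z, t). (7 * t - 2 * y - 3 * z, y, z) :: int \<times> int \<times> int"
  let ?g = "\<lambda>(y, z, t). (2 * y + z - 3 * t, 2 * t, z - t) :: int \<times> int \<times> int"
  have val: "3 * (2 * y + z - 3 * t)\<^sup>2 + 5 * (2 * t)\<^sup>2 + 14 * (z - t)\<^sup>2 + 2 * (2 * y + z - 3 * t) * (2 * t)
      = (7 * t - 2 * y - 3 * z)\<^sup>2 + 8 * y\<^sup>2 + 8 * z\<^sup>2" for y z t :: int
    by (simp add: power2_eq_square algebra_simps)
  have f: "line_reps N 2 3 = ?f ` ?P"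
  proof (intro equalityI subsetI)
    fix p assume "p \<in> line_reps N 2 3"
    then obtain x y z where p: "p = (x, y, z)" "x\<^sup>2 + 8 * y\<^sup>2 + 8 * z\<^sup>2 = N" "7 dvd x + 2 * y + 3 * z"
      by (auto simp: line_reps_def)
    obtain t where "x + 2 * y + 3 * z = 7 * t" using p(3) by (rule dvdE)
    then have x: "x = 7 * t - 2 * y - 3 * z" by simp
    show "p \<in> ?f ` ?P"
      by (rule image_eqI[of _ _ "(y, z, t)"]) (use p(1,2) in \<open>simp_all add: x[symmetric]\<close>)
  qed (auto simp: line_reps_def)
  have g: "{(x, y, z). 3 * x\<^sup>2 + 5 * y\<^sup>2 + 14 * z\<^sup>2 + 2 * x * y = N} = ?g ` ?P"
  proof (intro equalityI subsetI)
    fix p assume "p \<in> {(x, y, z). 3 * x\<^sup>2 + 5 * y\<^sup>2 + 14 * z\<^sup>2 + 2 * x * y = N}"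
    then obtain x y z where p: "p = (x, y, z)" "3 * x\<^sup>2 + 5 * y\<^sup>2 + 14 * z\<^sup>2 + 2 * x * y = N" by auto
    obtain t where t: "y = 2 * t" using conjunct1[OF form_3_5_14_parity[OF N p(2)]] by (rule evenE)
    obtain s where s: "z - x = 2 * s" using conjunct2[OF form_3_5_14_parity[OF N p(2)]] by (rule evenE)
    define Y where "Y = t - s"
    define Z where "Z = z + t"
    have x: "x = 2 * Y + Z - 3 * t" and z: "z = Z - t" using s by (simp_all add: Y_def Z_def)
    have "(Y, Z, t) \<in> ?P" using p(2) val[of Y Z t] unfolding x z t by simp
    moreover have "p = ?g (Y, Z, t)" using p(1) x z t by simp
    ultimately show "p \<in> ?g ` ?P" by blast
  next
    fix p assume "p \<in> ?g ` ?P"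
    then obtain y z t where "p = (2 * y + z - 3 * t, 2 * t, z - t)" "(7 * t - 2 * y - 3 * z)\<^sup>2 + 8 * y\<^sup>2 + 8 * z\<^sup>2 = N"
      by auto
    then show "p \<in> {(x, y, z). 3 * x\<^sup>2 + 5 * y\<^sup>2 + 14 * z\<^sup>2 + 2 * x * y = N}"
      using val[of y z t] by simp
  qed
  have "inj_on ?f ?P" "inj_on ?g ?P" by (auto simp: inj_on_def)
  then show ?thesis unfolding f g by (simp only: card_image)
qed

section \<open>The two identities\<close>

lemma rep_count_of_nat:
  "rep_count a b c d e f (of_nat M) =
    card {(x, y, z). a * x\<^sup>2 + b * y\<^sup>2 + c * z\<^sup>2 + d * y * z + e * z * x + f * x * y = int M}"
proof -
  have "(of_nat M = (of_int t :: rat)) \<longleftrightarrow> t = int M" for t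
    by (metis of_int_eq_iff of_int_of_nat_eq)
  then show ?thesis unfolding rep_count_def by (simp only:)
qed

lemma rep_count_of_nat_div_49:
  "rep_count a b c d e f (of_nat M / 7 ^ 2) =
    (if 49 dvd int M
     then card {(x, y, z). a * x\<^sup>2 + b * y\<^sup>2 + c * z\<^sup>2 + d * y * z + e * z * x + f * x * y = int M div 49}
     else 0)"
proof -
  have "(of_nat M / 7 ^ 2 = (of_int t :: rat)) \<longleftrightarrow> int M = 49 * t" for t
  proof -
    have "(of_nat M / 7 ^ 2 = (of_int t :: rat)) \<longleftrightarrow> (of_int (int M) :: rat) = of_int (49 * t)"
      by (simp add: field_simps)
    then show ?thesis by (simp only: of_int_eq_iff)
  qed
  note eq = this
  show ?thesis
  proof (cases "49 dvd int M")
    case True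
    then have "int M = 49 * t \<longleftrightarrow> t = int M div 49" for t by auto
    then show ?thesis unfolding rep_count_def eq using True by (simp only: if_True)
  next
    case False
    then have ne: "int M = 49 * t \<longleftrightarrow> False" for t by auto
    show ?thesis unfolding rep_count_def eq ne using False by (simp add: case_prod_unfold)
  qed
qed

lemma sqrt_count_multiple_7:
  assumes "7 dvd N"
  shows "sqrt_count N = (if 49 dvd N then sqrt_count (N div 49) else 0)"
proof -
  have sq: "7 dvd x" if "x\<^sup>2 = N" for x
    using assms unfolding that[symmetric] by (subst (asm) prime_dvd_power_iff) auto
  show ?thesis
  proof (cases "49 dvd N")
    case True
    then obtain K where K: "N = 49 * K" by (rule dvdE)
    have "{x. x\<^sup>2 = N} = (\<lambda>x. 7 * x) ` {x. x\<^sup>2 = K}"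
    proof (intro equalityI subsetI)
      fix x assume "x \<in> {x. x\<^sup>2 = N}"
      then have x: "x\<^sup>2 = N" by simp
      obtain y where y: "x = 7 * y" using sq[OF x] by (rule dvdE)
      then have "y\<^sup>2 = K" using x by (simp add: K power_mult_distrib)
      then show "x \<in> (\<lambda>x. 7 * x) ` {x. x\<^sup>2 = K}" using y by simp
    qed (auto simp: K power_mult_distrib)
    then show ?thesis using K by (simp add: sqrt_count_def card_image inj_on_def)
  next
    case False
    have "{x. x\<^sup>2 = N} = {}"
    proof (rule equals0I)
      fix x assume "x \<in> {x. x\<^sup>2 = N}"
      then have x: "x\<^sup>2 = N" by simp
      obtain y where "x = 7 * y" using sq[OF x] by (rule dvdE)
      then have "N = 49 * y\<^sup>2" using x by (simp add: power_mult_distrib)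
      then show False using False by simp
    qed
    then show ?thesis using False by (simp add: sqrt_count_def)
  qed
qed

text \<open>The relations express the eight-point sum, up to boundary terms, as -4 times the odd sum
  at (0 : 1) plus 2 times that at (1 : 3). Multiplied by -2, this is the combination in the two
  counts.\<close>

lemma card_genus_1_14_14:
  assumes N: "N mod 8 = 1" "N > 0"
  shows "int (card {(x, y, z). x\<^sup>2 + 14 * y\<^sup>2 + 14 * z\<^sup>2 = N})
      + 2 * int (card {(x, y, z). 2 * x\<^sup>2 + 7 * y\<^sup>2 + 14 * z\<^sup>2 = N})
    = - 2 * (\<Sum>(a, b, c)\<in>simple_forms N. if odd b then chi c * root_count a b c else 0)
      + (if 7 dvd N then - 3 else 1) * sqrt_count N"
proof -
  have "int (card {(x, y, z). 2 * x\<^sup>2 + 7 * y\<^sup>2 + 14 * z\<^sup>2 = N})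
      = 2 * (odd_root_sum N 0 1 - odd_root_sum N 1 3 + boundary_sum (4 * N) 0 1)"
    using card_form_2_7_14[OF N(1)] card_odd_triples_7_28[OF N(1)] sum_odd_middle_4[OF N(1)] by linarith
  then show ?thesis
    using card_form_1_14_14[OF N] eight_point_sum[of N] odd_root_sum_relations[OF N(1)]
      odd_root_sum_10[of N] boundary_combination[OF N]
    by (simp only: algebra_simps)
qed

theorem theorem1p2:
  fixes M :: nat
  assumes "0 < M" and "[M = 1] (mod 8)"
  shows "rep_count 1 8 8 0 0 0 (of_nat M)
           = rep_count 1 14 14 0 0 0 (of_nat M)
             + 2 * rep_count 2 7 14 0 0 0 (of_nat M)
             + 4 * rep_count 3 5 14 0 0 2 (of_nat M)
       \<and> (7 dvd M \<longrightarrow>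
           7 * int (rep_count 1 8 8 0 0 0 (of_nat M / 7 ^ 2))
           = - int (rep_count 1 14 14 0 0 0 (of_nat M))
             - 2 * int (rep_count 2 7 14 0 0 0 (of_nat M))
             + 4 * int (rep_count 3 5 14 0 0 2 (of_nat M)))"
proof -
  define N where "N = int M"
  have "M mod 8 = 1" using assms(2) by (simp add: cong_def)
  then have N: "N mod 8 = 1" "N > 0"
    using assms(1) zmod_int[of M 8] unfolding N_def by simp_all
  have dvd: "7 dvd M \<longleftrightarrow> 7 dvd N" using int_dvd_int_iff[of 7 M] unfolding N_def by simp
  define F where "F = int (card (reps_1_8_8 N))"
  define F' where "F' = (if 49 dvd N then int (card (reps_1_8_8 (N div 49))) else 0)"
  define A where "A = int (rep_count 1 14 14 0 0 0 (of_nat M)) + 2 * int (rep_count 2 7 14 0 0 0 (of_nat M))"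
  define B where "B = int (rep_count 3 5 14 0 0 2 (of_nat M))"
  have F: "int (rep_count 1 8 8 0 0 0 (of_nat M)) = F"
    unfolding rep_count_of_nat F_def N_def reps_1_8_8_def by simp
  have F': "int (rep_count 1 8 8 0 0 0 (of_nat M / 7 ^ 2)) = F'"
    unfolding rep_count_of_nat_div_49 F'_def N_def reps_1_8_8_def by simp
  have F_eq: "F = - 4 * odd_sum N + sqrt_count N"
    using card_form_1_8_8[OF N] by (simp add: F_def reps_1_8_8_def)
  have A_eq: "A = - 2 * (\<Sum>(a, b, c)\<in>simple_forms N. if odd b then chi c * root_count a b c else 0)
      + (if 7 dvd N then - 3 else 1) * sqrt_count N"
    using card_genus_1_14_14[OF N] by (simp add: A_def rep_count_of_nat N_def)
  have B_eq: "8 * B = (if 7 dvd N then F + 7 * F' else if N mod 7 \<in> {1, 2, 4} then 0 else 2 * F)"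
    using card_form_3_5_14[OF N(1)] card_line_reps[of N]
    by (simp add: B_def rep_count_of_nat F_def F'_def N_def)
  \<comment> \<open>If 7 divides N, both claims follow from 2A = F - 7F' and 8B = F + 7F'. Otherwise
    A = F and B = 0, or A = 0 and 4B = F, as N is a square modulo 7 or not.\<close>
  have "F = A + 4 * B \<and> (7 dvd N \<longrightarrow> 7 * F' = - A + 4 * B)"
  proof (cases "7 dvd N")
    case True
    have "F' = (if 49 dvd N then - 4 * odd_sum (N div 49) + sqrt_count (N div 49) else 0)"
    proof (cases "49 dvd N")
      case True
      then obtain K where K: "N = 49 * K" by (rule dvdE)
      obtain k where "N = 8 * k + 1" using N(1) by (rule mod_8_1_obtain)
      \<comment> \<open>As 49 is 1 modulo 8, N / 49 is again 1 modulo 8.\<close>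
      then have "K = 8 * (k - 6 * K) + 1" using K by simp
      then obtain l where "K = 8 * l + 1" by blast
      then have "K mod 8 = 1" by simp
      moreover have "K > 0" using N(2) K by simp
      ultimately show ?thesis using card_form_1_8_8[of K] K by (simp add: F'_def reps_1_8_8_def)
    qed (simp add: F'_def)
    then have "A = - 2 * odd_sum N - 3 * sqrt_count N
        + (if 49 dvd N then 14 * odd_sum (N div 49) else 0)"
      and "2 * A = F - 7 * F'"
      using True A_eq F_eq eight_point_sum_eq[of N] sqrt_count_multiple_7[OF True]
      by (simp_all split: if_splits)
    moreover have "8 * B = F + 7 * F'" using B_eq True by simp
    ultimately show ?thesis by linarith
  next
    case False
    show ?thesis
    proof (cases "N mod 7 \<in> {1, 2, 4}")
      case True
      then have "A = F" "B = 0" using False A_eq F_eq B_eq eight_point_sum_eq[of N] by auto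
      then show ?thesis using False by simp
    next
      case qnr: False
      have "sqrt_count N = 0"
      proof -
        have "x\<^sup>2 \<noteq> N" for x
        proof
          assume x: "x\<^sup>2 = N"
          have "\<forall>r\<in>set [0..6 :: int]. (r * r) mod 7 \<in> {0, 1, 2, 4}" by code_simp
          moreover have "x mod 7 \<in> set [0..6]" using pos_mod_bound[of 7 x] by simp
          ultimately have "((x mod 7) * (x mod 7)) mod 7 \<in> {0, 1, 2, 4}" by (rule bspec)
          then have "N mod 7 \<in> {0, 1, 2, 4}" unfolding x[symmetric] power2_eq_square by (simp only: mod_mult_eq)
          then show False using qnr False by (simp add: dvd_eq_mod_eq_0)
        qed
        then show ?thesis by (simp add: sqrt_count_def)
      qed
      then have "A = 0" "8 * B = 2 * F" using qnr False A_eq B_eq eight_point_sum_eq[of N] by auto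
      then show ?thesis using False by simp
    qed
  qed
  then show ?thesis
    unfolding dvd F' using F by (auto simp: A_def B_def simp flip: of_nat_eq_iff[where 'a = int])
qed

end
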